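(* Let $O_1,\dots,O_L$ be jointly distributed binary observations and let $H$ be an $r\times L$ binary matrix with distinct rows $h_1,\dots,h_r$. Let $f_1,\dots,f_b:\{0,1\}^L\to$ (some finite sets) be functions such that for every $i\in[1:b]$, $f_i(o)=f_i(o')$ whenever $o,o'\in\{0,1\}^L$ satisfy $Ho^t=Ho'^t$ over $\mathbb{F}_2$. For $i\in[1:r]$ let $V_i=\bigoplus_{j=1}^L h_i[j]\,O_j$ (sum modulo $2$), and let $\mathfrak{R}$ be the common-compression Slepian–Wolf rate $R^{s.c.}_{SW}$ of $(V_1,\dots,V_r)$. Then for every signature length $N>r$, in the CDMA function-computation model below with targets $U_i=f_i(O_1,\dots,O_L)$, every rate $R<\frac{c}{N\mathfrak{R}}$ is achievable; hence the computational capacity satisfies $$C_N\ \ge\ \frac{c}{N\cdot\mathfrak{R}}\ \ge\ \frac{c}{N\cdot \max_{1\le i\le r} H\big(\bigoplus_{j=1}^L h_i[j]O_j\big)},$$ (with the convention $c/0=\infty$). Here $c$ is the capacity of the channel with input $W\in\{0,1\}$ whose output is $W+Z'$ reduced modulo $2$ into the interval $[-\tfrac12,\tfrac32)$ (i.e. the unique element of $[-\tfrac12,\tfrac32)$ differing from $W+Z'$ by an integer multiple of $2$), where $Z'\sim\mathcal{N}\big(0,\sigma^2/\lfloor N/r\rfloor\big)$ is independent of $W$.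
   Context: CDMA function-computation model: there are $L$ transmitters; transmitter $i$ observes $O_i^k=(O_i[1],\dots,O_i[k])$, where $(O_1[t],\dots,O_L[t])$, $t=1,\dots,k$, are i.i.d. copies of $(O_1,\dots,O_L)$. The receiver wants i.i.d. copies $U_i^k$ of $U_i=f_i(O_1,\dots,O_L)$, $i\in[1:b]$. A code with signature length $N$ consists of: (1) for each transmitter $i$ an encoder mapping $O_i^k$ to a binary sequence $T_i^n\in\{0,1\}^n$; (2) a binary signature vector $\mathbf{s}_i\in\{0,1\}^N$ for each transmitter $i$; (3) a decoder at the receiver. Transmitter $i$ sends $X_i^{nN}$, obtained by multiplying each bit $T_i[m]$, $m=1,\dots,n$, by the whole vector $\mathbf{s}_i$ and concatenating. The receiver observes $Y[m]=\sum_{j=1}^L X_j[m]+Z[m]$, $m\in[1:nN]$ (real addition), where $Z[m]$ are i.i.d. $\mathcal{N}(0,\sigma^2)$ independent of everything else, and outputs estimates $\widehat U_i^k$, $i\in[1:b]$. The error probability is $\Pr[\widehat U_i^k\neq U_i^k\text{ for some }i]$ and the rate is $k/(nN)$. For fixed $N$, a rate $R_N$ is achievable if there is a sequence of codes with signature length $N$ whose error probabilities tend to $0$ and whose rates tend to $R_N$; the computational capacity $C_N$ is the supremum of achievable rates. Common-compression Slepian–Wolf rate: for jointly distributed binary $V_1,\dots,V_r$ with i.i.d. copies $V_i^n\in\mathbb{F}_2^n$, a rate $R$ is achievable with a common compression matrix if for every $\epsilon>0$ and all large $n$ there exist a single binary $\lceil nR\rceil\times n$ matrix $B$ and a decoder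 recovering $(V_1^n,\dots,V_r^n)$ from $(BV_1^n,\dots,BV_r^n)$ (products over $\mathbb{F}_2$) with error probability at most $\epsilon$; $R^{s.c.}_{SW}$ is the infimum of such rates. $H(\cdot)$ is Shannon entropy in bits. *)

theory Defs
  imports "HOL-Probability.Probability"
begin

definition dotF2 :: "('l::finite \<Rightarrow> bool) \<Rightarrow> ('l \<Rightarrow> bool) \<Rightarrow> bool" where
  "dotF2 h x = odd (card {j. h j \<and> x j})"

definition iid :: "nat \<Rightarrow> 'a pmf \<Rightarrow> (nat \<Rightarrow> 'a) pmf" where
  "iid n Q = Pi_pmf {..<n} undefined (\<lambda>_. Q)"

text \<open>Q is the joint distribution of (V_1,...,V_r), as a list of length r.
  A sample block is omega :: nat => bool list, omega t ! i = V_i[t].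
  The compressed version of V_i^n is B V_i^n over F2, B a ceil(nR) x n matrix.\<close>
definition sw_compress :: "nat \<Rightarrow> nat \<Rightarrow> nat \<Rightarrow> (nat \<Rightarrow> nat \<Rightarrow> bool) \<Rightarrow> (nat \<Rightarrow> bool list)
    \<Rightarrow> nat \<Rightarrow> nat \<Rightarrow> bool" where
  "sw_compress r m n B \<omega> = (\<lambda>i a. if i < r \<and> a < m
      then odd (card {t. t < n \<and> B a t \<and> \<omega> t ! i}) else False)"

definition sw_achievable :: "bool list pmf \<Rightarrow> nat \<Rightarrow> real \<Rightarrow> bool" where
  "sw_achievable Q r R \<longleftrightarrow> 0 \<le> R \<and>
     (\<forall>\<epsilon>>0. \<exists>n0. \<forall>n\<ge>n0. \<exists>(B :: nat \<Rightarrow> nat \<Rightarrow> bool)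
        (dec :: (nat \<Rightarrow> nat \<Rightarrow> bool) \<Rightarrow> nat \<Rightarrow> bool list).
        measure_pmf.prob (iid n Q)
          {\<omega>. \<exists>t<n. dec (sw_compress r (nat \<lceil>real n * R\<rceil>) n B \<omega>) t \<noteq> \<omega> t} \<le> \<epsilon>)"

definition sw_rate :: "bool list pmf \<Rightarrow> nat \<Rightarrow> real" where
  "sw_rate Q r = Inf {R. sw_achievable Q r R}"

definition mod2_wrap :: "real \<Rightarrow> real" where
  "mod2_wrap y = y - 2 * of_int \<lfloor>(y + 1/2) / 2\<rfloor>"

definition mod_channel_capacity :: "real \<Rightarrow> real" where
  "mod_channel_capacity s =
     (SUP p :: bool pmf. prob_space.mutual_information
        (measure_pmf p \<Otimes>\<^sub>M density lborel (normal_density 0 s)) 2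
        (count_space UNIV) borel fst
        (\<lambda>(w, z). mod2_wrap ((if w then 1 else 0) + z)))"

definition cdma_noise :: "real \<Rightarrow> nat \<Rightarrow> (nat \<Rightarrow> real) measure" where
  "cdma_noise \<sigma> len = PiM {..<len} (\<lambda>_. density lborel (normal_density 0 \<sigma>))"

text \<open>Received signal. enc j maps O_j^k (positions t<k) to T_j^n (positions m<n);
  s j is the signature vector (positions q<N); X_j[mN+q] = T_j[m] s_j[q];
  Y[p] = sum_j X_j[p] + Z[p] for p < nN.\<close>
definition cdma_received :: "nat \<Rightarrow> nat \<Rightarrow> nat \<Rightarrow> ('l::finite \<Rightarrow> (nat \<Rightarrow> bool) \<Rightarrow> nat \<Rightarrow> bool)
    \<Rightarrow> ('l \<Rightarrow> nat \<Rightarrow> bool) \<Rightarrow> (nat \<Rightarrow> 'l \<Rightarrow> bool) \<Rightarrow> (nat \<Rightarrow> real) \<Rightarrow> nat \<Rightarrow> real" where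
  "cdma_received N k n enc s \<omega> z = (\<lambda>p. if p < n * N then
      (\<Sum>j\<in>UNIV. (if enc j (\<lambda>t. if t < k then \<omega> t j else False) (p div N) \<and> s j (p mod N)
                    then 1 else 0)) + z p
      else undefined)"

definition cdma_error_prob :: "('l::finite \<Rightarrow> bool) pmf \<Rightarrow> (nat \<Rightarrow> ('l \<Rightarrow> bool) \<Rightarrow> 'b) \<Rightarrow> nat
    \<Rightarrow> real \<Rightarrow> nat \<Rightarrow> nat \<Rightarrow> nat \<Rightarrow> ('l \<Rightarrow> (nat \<Rightarrow> bool) \<Rightarrow> nat \<Rightarrow> bool) \<Rightarrow> ('l \<Rightarrow> nat \<Rightarrow> bool)
    \<Rightarrow> ((nat \<Rightarrow> real) \<Rightarrow> nat \<Rightarrow> nat \<Rightarrow> 'b) \<Rightarrow> real" where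
  "cdma_error_prob P f b \<sigma> N k n enc s dec =
     measure_pmf.expectation (iid k P) (\<lambda>\<omega>.
       measure (cdma_noise \<sigma> (n * N))
         {z \<in> space (cdma_noise \<sigma> (n * N)).
            \<exists>i<b. \<exists>t<k. dec (cdma_received N k n enc s \<omega> z) i t \<noteq> f i (\<omega> t)})"

definition cdma_decoder_measurable :: "nat \<Rightarrow> nat \<Rightarrow> nat \<Rightarrow> nat
    \<Rightarrow> ((nat \<Rightarrow> real) \<Rightarrow> nat \<Rightarrow> nat \<Rightarrow> 'b) \<Rightarrow> bool" where
  "cdma_decoder_measurable b N k n dec \<longleftrightarrow>
     (\<forall>i<b. \<forall>t<k. (\<lambda>y. dec y i t) \<in> measurable (PiM {..<n * N} (\<lambda>_. borel)) (count_space UNIV))"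

definition cdma_achievable :: "('l::finite \<Rightarrow> bool) pmf \<Rightarrow> (nat \<Rightarrow> ('l \<Rightarrow> bool) \<Rightarrow> 'b) \<Rightarrow> nat
    \<Rightarrow> real \<Rightarrow> nat \<Rightarrow> real \<Rightarrow> bool" where
  "cdma_achievable P f b \<sigma> N R \<longleftrightarrow>
     (\<exists>(kk :: nat \<Rightarrow> nat) (nn :: nat \<Rightarrow> nat)
        (enc :: nat \<Rightarrow> 'l \<Rightarrow> (nat \<Rightarrow> bool) \<Rightarrow> nat \<Rightarrow> bool)
        (s :: nat \<Rightarrow> 'l \<Rightarrow> nat \<Rightarrow> bool)
        (dec :: nat \<Rightarrow> (nat \<Rightarrow> real) \<Rightarrow> nat \<Rightarrow> nat \<Rightarrow> 'b).
        (\<forall>m. 0 < nn m \<and> cdma_decoder_measurable b N (kk m) (nn m) (dec m)) \<and>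
        (\<lambda>m. cdma_error_prob P f b \<sigma> N (kk m) (nn m) (enc m) (s m) (dec m)) \<longlonglongrightarrow> 0 \<and>
        (\<lambda>m. real (kk m) / (real (nn m) * real N)) \<longlonglongrightarrow> R)"

definition cdma_capacity :: "('l::finite \<Rightarrow> bool) pmf \<Rightarrow> (nat \<Rightarrow> ('l \<Rightarrow> bool) \<Rightarrow> 'b) \<Rightarrow> nat
    \<Rightarrow> real \<Rightarrow> nat \<Rightarrow> ereal" where
  "cdma_capacity P f b \<sigma> N = Sup {ereal R | R. cdma_achievable P f b \<sigma> N R}"

definition div_inf :: "real \<Rightarrow> real \<Rightarrow> ereal" where
  "div_inf c x = (if x = 0 then \<infinity> else ereal (c / x))"

end

(* Each transmitter applies the same binary linear maps: it compresses O_j by a Slepian-Wolf matrix B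
   and encodes the result by a channel code G. Giving every row h_a a block of N div r signature
   positions, in which the signature bit of transmitter j is h_a[j], and averaging the receptions of a
   block, the receiver sees modulo 2 the word G B V_a plus noise of variance sigma^2 / (N div r),
   because reduction modulo 2 turns the real superposition into the F2-linear map h_a. It thus decodes
   B V_a for every a, then V by the Slepian-Wolf decoder, and V determines every f_i.

   Random linear codes achieve c: uniform input maximises the mutual information by the symmetry of the
   channel, and threshold decoding with the likelihood ratio between a 0 input and a uniform input works
   since the ratios at y and y + 1 sum to 2, so that a random codeword has average ratio 1.
   Mixing the ratio with the constant 1 makes its logarithm bounded, so Hoeffding's inequality applies.
   That c > 0, which matters when the Slepian-Wolf rate is 0, follows from the nonvanishing
   characteristic function of the noise at pi. *)
theory Submission
  imports Defs
begin

section \<open>Parities and random binary matrices\<close>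

text \<open>The error analysis rests on linearity. A wrong hypothesis enters only through its
  difference from the true message, so channel errors become events of the noise alone, free of the
  source. Hence no random translate of the channel code is required, and one channel matrix suits
  every source outcome. A single matrix also suits all rows of h: the error bounds are added over
  the rows before averaging over the finite set of matrices. The only fact used about a random
  matrix is that it maps each fixed nonzero vector to independent fair bits. The capacity is a
  supremum over input laws. Instead of finding where it is attained, the proof bounds the
  information of every input by the mean logarithm of the mixed ratio plus a constant that vanishes
  with the mixing weight. All densities are taken with respect to the output law of the uniform
  input: likelihoods are then at most 2, which settles integrability. Ratio identities given by a
  density only almost everywhere are turned into pointwise ones, because the decoder evaluates the
  ratio at shifted receptions.\<close>

lemma sum_UNIV_bool: "(\<Sum>w\<in>UNIV. F w) = F True + (F False :: 'a::comm_monoid_add)"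
  by (simp add: UNIV_bool add.commute)

lemma odd_card_iff_odd_sum:
  "finite A \<Longrightarrow> odd (card {x \<in> A. P x}) \<longleftrightarrow> odd (\<Sum>x\<in>A. of_bool (P x) :: nat)"
  by (simp add: Int_def flip: sum.inter_filter)

text \<open>Associativity of a product row times matrix times column over F2: both sides are the
  parity of the number of pairs (j, t) with \<open>g j\<close>, \<open>b t\<close> and
  \<open>x j t\<close>. It moves the sum over transmitters past the sums made by the
  encoder.\<close>

lemma odd_card_product_swap:
  assumes "finite J" "finite T"
  shows "odd (card {j \<in> J. g j \<and> odd (card {t \<in> T. b t \<and> x j t})})
     \<longleftrightarrow> odd (card {t \<in> T. b t \<and> odd (card {j \<in> J. g j \<and> x j t})})"
proof -
  \<comment> \<open>This claim has type variables of its own, so that it applies to (J, T) and to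
    (T, J).\<close>
  have "odd (card {j \<in> J. g j \<and> odd (card {t \<in> T. b t \<and> x j t})})
      \<longleftrightarrow> odd (\<Sum>j\<in>J. \<Sum>t\<in>T. of_bool (g j \<and> b t \<and> x j t) :: nat)"
    if "finite J" "finite T" for J :: "'c set" and T :: "'d set" and g b x
  proof -
    have "odd (card {j \<in> J. g j \<and> odd (card {t \<in> T. b t \<and> x j t})})
      \<longleftrightarrow> odd (\<Sum>j\<in>J. of_bool (g j) * of_bool (odd (\<Sum>t\<in>T. of_bool (b t \<and> x j t) :: nat)) :: nat)"
      by (simp only: odd_card_iff_odd_sum[OF that(1)] odd_card_iff_odd_sum[OF that(2)] of_bool_conj)
    \<comment> \<open>Only the parity of each summand matters, so the inner parity may be replaced
      by the inner count.\<close>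
    also have "\<dots> \<longleftrightarrow> odd (\<Sum>j\<in>J. of_bool (g j) * (\<Sum>t\<in>T. of_bool (b t \<and> x j t)) :: nat)"
    proof -
      have par: "even (\<Sum>j\<in>J. f j) \<longleftrightarrow> even (\<Sum>j\<in>J. f' j)"
        if "\<And>j. even (f j) \<longleftrightarrow> even (f' j)" for f f' :: "'c \<Rightarrow> nat"
        using \<open>finite J\<close> that by (simp add: even_sum_iff)
      show ?thesis
        by (intro arg_cong[where f=Not] par) auto
    qed
    also have "(\<Sum>j\<in>J. of_bool (g j) * (\<Sum>t\<in>T. of_bool (b t \<and> x j t)) :: nat)
       = (\<Sum>j\<in>J. \<Sum>t\<in>T. of_bool (g j \<and> b t \<and> x j t))"
      by (simp add: sum_distrib_left of_bool_conj)
    finally show ?thesis .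
  qed
  note * = this
  show ?thesis
    unfolding *[OF assms] *[OF assms(2,1)]
    by (subst sum.swap) (simp add: conj_ac)
qed

text \<open>With subsets as supports of binary vectors, \<open>sym_diff\<close> is addition and the
  parity of an intersection is an inner product. The common points of u and v are counted twice on
  the right and cancel.\<close>

lemma odd_card_sym_diff:
  assumes "finite u" "finite v"
  shows "odd (card (R \<inter> sym_diff u v)) \<longleftrightarrow> odd (card (R \<inter> u)) \<noteq> odd (card (R \<inter> v))"
proof -
  have "card (R \<inter> u) = card (R \<inter> (u - v)) + card (R \<inter> (u \<inter> v))"
    using assms by (subst card_Un_disjoint[symmetric]) (auto intro!: arg_cong[where f=card])
  moreover have "card (R \<inter> v) = card (R \<inter> (v - u)) + card (R \<inter> (u \<inter> v))"
    using assms by (subst card_Un_disjoint[symmetric]) (auto intro!: arg_cong[where f=card])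
  moreover have "card (R \<inter> sym_diff u v) = card (R \<inter> (u - v)) + card (R \<inter> (v - u))"
    using assms by (subst card_Un_disjoint[symmetric]) (auto intro!: arg_cong[where f=card])
  ultimately show ?thesis by auto
qed

text \<open>A uniform vector has a fair inner product with any nonzero vector: toggling one fixed
  element of D is a bijection of the power set that flips the parity.\<close>

lemma sum_Pow_parity:
  fixes F :: "bool \<Rightarrow> real"
  assumes "finite A" "D \<subseteq> A" "D \<noteq> {}"
  shows "(\<Sum>b\<in>Pow A. F (odd (card (b \<inter> D)))) = card (Pow A) * ((F True + F False) / 2)"
proof -
  obtain d where d: "d \<in> D" using assms by blast
  let ?\<tau> = "\<lambda>b. sym_diff b {d}"
  have flip: "odd (card (?\<tau> b \<inter> D)) \<longleftrightarrow> \<not> odd (card (b \<inter> D))" if "b \<subseteq> A" for b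
    using odd_card_sym_diff[of b "{d}" D] that d assms
    by (auto simp: Int_commute finite_subset)
  have bij: "bij_betw ?\<tau> (Pow A) (Pow A)"
    using d assms by (intro bij_betw_byWitness[where f'="?\<tau>"]) auto
  have "(\<Sum>b\<in>Pow A. F (odd (card (b \<inter> D)))) = (\<Sum>b\<in>Pow A. F (odd (card (?\<tau> b \<inter> D))))"
    using sum.reindex_bij_betw[OF bij, of "\<lambda>b. F (odd (card (b \<inter> D)))"] by simp
  then have "2 * (\<Sum>b\<in>Pow A. F (odd (card (b \<inter> D))))
      = (\<Sum>b\<in>Pow A. F (odd (card (b \<inter> D)))) + (\<Sum>b\<in>Pow A. F (odd (card (?\<tau> b \<inter> D))))"
    by simp
  also have "\<dots> = (\<Sum>b\<in>Pow A. F (odd (card (b \<inter> D))) + F (odd (card (?\<tau> b \<inter> D))))"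
    by (simp only: sum.distrib)
  also have "\<dots> = (\<Sum>b\<in>Pow A. F True + F False)"
  proof (rule sum.cong[OF refl])
    fix b assume "b \<in> Pow A"
    then have "b \<subseteq> A" by simp
    from flip[OF this] show "F (odd (card (b \<inter> D))) + F (odd (card (?\<tau> b \<inter> D))) = F True + F False"
      by (cases "odd (card (b \<inter> D))") auto
  qed
  finally show ?thesis by simp
qed

text \<open>A binary m x l matrix is given by the supports of its rows, so
  \<open>odd (card (G a \<inter> D))\<close> is entry a of its product with the vector of support D.
  Averages over matrices are finite sums.\<close>

definition matrices :: "nat \<Rightarrow> nat \<Rightarrow> (nat \<Rightarrow> nat set) set" where
  "matrices m l = (\<Pi>\<^sub>E a\<in>{..<m}. Pow {..<l})"

lemma finite_matrices [simp]: "finite (matrices m l)"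
  by (simp add: matrices_def finite_PiE)

lemma card_matrices_pos [simp]: "0 < card (matrices m l)"
  by (simp add: matrices_def card_PiE card_Pow)

text \<open>The rows are chosen independently and each yields a fair bit on a nonzero D, so the mean
  of the product is the product of the means.\<close>

lemma sum_matrices_prod:
  fixes F :: "nat \<Rightarrow> bool \<Rightarrow> real"
  assumes "D \<subseteq> {..<l}" "D \<noteq> {}"
  shows "(\<Sum>G\<in>matrices m l. \<Prod>a<m. F a (odd (card (G a \<inter> D))))
     = card (matrices m l) * (\<Prod>a<m. (F a True + F a False) / 2)"
proof -
  have "(\<Sum>G\<in>matrices m l. \<Prod>a<m. F a (odd (card (G a \<inter> D))))
     = (\<Prod>a<m. \<Sum>b\<in>Pow {..<l}. F a (odd (card (b \<inter> D))))"
    unfolding matrices_def by (rule prod_sum_PiE[symmetric]) auto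
  also have "\<dots> = (\<Prod>a<m. real (card (Pow {..<l})) * ((F a True + F a False) / 2))"
    by (intro prod.cong refl sum_Pow_parity) (use assms in auto)
  also have "\<dots> = card (matrices m l) * (\<Prod>a<m. (F a True + F a False) / 2)"
    by (simp only: prod.distrib) (simp add: matrices_def card_PiE)
  finally show ?thesis .
qed

section \<open>Averaging, concentration and counting bounds\<close>

lemma exists_le_average:
  fixes F :: "'a \<Rightarrow> real"
  assumes "finite S" "0 < card S" "(\<Sum>x\<in>S. F x) \<le> real (card S) * c"
  shows "\<exists>x\<in>S. F x \<le> c"
proof (rule ccontr)
  assume "\<not> ?thesis"
  then have "(\<Sum>x\<in>S. c) < (\<Sum>x\<in>S. F x)"
    using assms by (intro sum_strict_mono) (auto simp: card_gt_0_iff not_le)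
  with assms show False by simp
qed

text \<open>Hoeffding's inequality for terms in [-K, K], an interval of width 2K; this width
  accounts for the constant in the exponent.\<close>

lemma (in prob_space) bounded_sum_lower_tail:
  fixes X :: "nat \<Rightarrow> 'a \<Rightarrow> real"
  assumes indep: "indep_vars (\<lambda>_. borel) X {..<n}"
    and bd: "\<And>i x. i < n \<Longrightarrow> \<bar>X i x\<bar> \<le> K"
    and mu: "\<And>i. i < n \<Longrightarrow> expectation (X i) = \<mu>"
    and "\<gamma> \<le> \<mu>" "0 < K" "0 < n"
  shows "prob {x\<in>space M. (\<Sum>i<n. X i x) \<le> n * \<gamma>} \<le> exp (- real n * ((\<mu> - \<gamma>)\<^sup>2 / (2 * K\<^sup>2)))"
proof -
  interpret H: Hoeffding_ineq M "{..<n}" X "\<lambda>_. -K" "\<lambda>_. K" "\<Sum>i<n. expectation (X i)"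
    by unfold_locales (use assms in \<open>auto simp: abs_le_iff minus_le_iff\<close>)
  have eq: "(\<Sum>i<n. expectation (X i)) - n * (\<mu> - \<gamma>) = n * \<gamma>"
    using mu by (simp add: algebra_simps)
  have "prob {x\<in>space M. (\<Sum>i<n. X i x) \<le> n * \<gamma>} \<le>
      exp (-2 * (n * (\<mu> - \<gamma>))\<^sup>2 / (\<Sum>i<n. (K - (-K))\<^sup>2))"
    using H.Hoeffding_ineq_le[of "n * (\<mu> - \<gamma>)"] assms unfolding eq by (simp add: power2_eq_square)
  also have "-2 * (n * (\<mu> - \<gamma>))\<^sup>2 / (\<Sum>i<n. (K - (-K))\<^sup>2) = - real n * ((\<mu> - \<gamma>)\<^sup>2 / (2 * K\<^sup>2))"
    using assms by (simp add: power2_eq_square field_simps)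
  finally show ?thesis .
qed

text \<open>Sum and expectation are exchanged. Random matrices enter in this way: for each fixed
  outcome the matrices bad for it are counted, which bounds the badness summed over all matrices,
  and an average then yields one good matrix.\<close>

lemma (in prob_space) sum_prob_le_count:
  assumes "finite S" and ev: "\<And>x. x \<in> S \<Longrightarrow> {\<omega>\<in>space M. C x \<omega>} \<in> events"
    and le: "\<And>\<omega>. \<omega> \<in> space M \<Longrightarrow> real (card {x\<in>S. C x \<omega>}) \<le> c"
  shows "(\<Sum>x\<in>S. prob {\<omega>\<in>space M. C x \<omega>}) \<le> c"
proof -
  have "(\<Sum>x\<in>S. prob {\<omega>\<in>space M. C x \<omega>})
      = (\<Sum>x\<in>S. expectation (indicator {\<omega>\<in>space M. C x \<omega>}))"
    using ev by simp
  also have "\<dots> = expectation (\<lambda>\<omega>. \<Sum>x\<in>S. indicator {\<omega>\<in>space M. C x \<omega>} \<omega>)"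
    using ev by (subst Bochner_Integration.integral_sum) (auto simp: emeasure_eq_measure)
  also have "\<dots> \<le> expectation (\<lambda>_. c)"
  proof (rule integral_mono)
    fix \<omega> assume \<omega>: "\<omega> \<in> space M"
    have "(\<Sum>x\<in>S. indicator {\<omega>\<in>space M. C x \<omega>} \<omega>) = (\<Sum>x\<in>S. if C x \<omega> then 1 else 0 :: real)"
      using \<omega> by (intro sum.cong) (auto simp: indicator_def)
    also have "\<dots> = real (card {x\<in>S. C x \<omega>})"
      using \<open>finite S\<close> by (simp flip: sum.inter_filter)
    finally show "(\<Sum>x\<in>S. indicator {\<omega>\<in>space M. C x \<omega>} \<omega>) \<le> c"
      using le[OF \<omega>] by simp
  next
    show "integrable M (\<lambda>\<omega>. \<Sum>x\<in>S. indicator {\<omega>\<in>space M. C x \<omega>} \<omega> :: real)"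
      using ev by (intro Bochner_Integration.integrable_sum) (auto simp: emeasure_eq_measure)
  qed simp
  finally show ?thesis by (simp add: prob_space)
qed

text \<open>Markov's inequality for the product under a uniform matrix.\<close>

lemma card_matrices_markov:
  fixes F :: "nat \<Rightarrow> bool \<Rightarrow> real"
  assumes "D \<subseteq> {..<l}" "D \<noteq> {}" and nn: "\<And>a b. 0 \<le> F a b"
  shows "real (card {G\<in>matrices m l. \<theta> \<le> (\<Prod>a<m. F a (odd (card (G a \<inter> D))))}) * \<theta>
    \<le> card (matrices m l) * (\<Prod>a<m. (F a True + F a False) / 2)"
proof -
  let ?P = "\<lambda>G. \<Prod>a<m. F a (odd (card (G a \<inter> D)))"
  have "real (card {G\<in>matrices m l. \<theta> \<le> ?P G}) * \<theta> = (\<Sum>G | G \<in> matrices m l \<and> \<theta> \<le> ?P G. \<theta>)"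
    by simp
  also have "\<dots> \<le> (\<Sum>G | G \<in> matrices m l \<and> \<theta> \<le> ?P G. ?P G)"
    by (intro sum_mono) auto
  also have "\<dots> \<le> (\<Sum>G\<in>matrices m l. ?P G)"
    by (intro sum_mono2) (auto intro: prod_nonneg nn)
  also have "\<dots> = card (matrices m l) * (\<Prod>a<m. (F a True + F a False) / 2)"
    by (rule sum_matrices_prod[OF assms(1,2)])
  finally show ?thesis .
qed

lemma card_ex_le:
  fixes c :: real
  assumes "finite S" "finite T" "\<And>y. y \<in> T \<Longrightarrow> real (card {x\<in>S. P x y}) \<le> c"
  shows "real (card {x\<in>S. \<exists>y\<in>T. P x y}) \<le> card T * c"
proof -
  have "{x\<in>S. \<exists>y\<in>T. P x y} = (\<Union>y\<in>T. {x\<in>S. P x y})" by auto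
  then have "card {x\<in>S. \<exists>y\<in>T. P x y} \<le> (\<Sum>y\<in>T. card {x\<in>S. P x y})"
    using card_UN_le[OF \<open>finite T\<close>, of "\<lambda>y. {x\<in>S. P x y}"] by simp
  then have "real (card {x\<in>S. \<exists>y\<in>T. P x y}) \<le> (\<Sum>y\<in>T. real (card {x\<in>S. P x y}))"
    by (simp flip: of_nat_sum)
  also have "\<dots> \<le> (\<Sum>y\<in>T. c)" by (intro sum_mono assms)
  finally show ?thesis by simp
qed

section \<open>Typical binary sequences\<close>

lemma sum_Pow_prod_pmf:
  fixes n :: nat
  shows "(\<Sum>v\<in>Pow {..<n}. \<Prod>t<n. pmf p (t \<in> v)) = (1::real)"
proof -
  have tot: "pmf p True + pmf p False = 1"
    using sum_pmf_eq_1[of UNIV p] by (simp add: sum_UNIV_bool)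
  \<comment> \<open>Expanding a product of n factors equal to 1: the term of v takes True on v and
    False elsewhere.\<close>
  have "(\<Prod>t<n. pmf p True + pmf p False)
      = (\<Sum>v\<in>Pow {..<n}. (\<Prod>t\<in>v. pmf p True) * (\<Prod>t\<in>{..<n}-v. pmf p False))"
    by (rule prod_add) simp
  also have "\<dots> = (\<Sum>v\<in>Pow {..<n}. \<Prod>t<n. pmf p (t \<in> v))"
  proof (rule sum.cong[OF refl])
    fix v assume "v \<in> Pow {..<n}"
    then have v: "v \<subseteq> {..<n}" by simp
    have "(\<Prod>t<n. pmf p (t \<in> v)) = (\<Prod>t\<in>{..<n}-v. pmf p (t \<in> v)) * (\<Prod>t\<in>v. pmf p (t \<in> v))"
      by (rule prod.subset_diff[OF v]) simp
    then show "(\<Prod>t\<in>v. pmf p True) * (\<Prod>t\<in>{..<n}-v. pmf p False) = (\<Prod>t<n. pmf p (t \<in> v))"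
      by (simp add: mult.commute)
  qed
  finally show ?thesis by (simp add: tot)
qed

text \<open>The probabilities of all sequences sum to 1, and each sequence counted contributes at
  least \<theta>.\<close>

lemma card_typical_le:
  fixes n :: nat
  assumes "0 < \<theta>"
  shows "real (card {v\<in>Pow {..<n}. \<theta> \<le> (\<Prod>t<n. pmf p (t \<in> v))}) \<le> 1 / \<theta>"
proof -
  have "real (card {v\<in>Pow {..<n}. \<theta> \<le> (\<Prod>t<n. pmf p (t \<in> v))}) * \<theta>
      = (\<Sum>v\<in>{v\<in>Pow {..<n}. \<theta> \<le> (\<Prod>t<n. pmf p (t \<in> v))}. \<theta>)"
    by simp
  also have "\<dots> \<le> (\<Sum>v\<in>{v\<in>Pow {..<n}. \<theta> \<le> (\<Prod>t<n. pmf p (t \<in> v))}. \<Prod>t<n. pmf p (t \<in> v))"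
    by (intro sum_mono) auto
  also have "\<dots> \<le> (\<Sum>v\<in>Pow {..<n}. \<Prod>t<n. pmf p (t \<in> v))"
    by (intro sum_mono2) (auto intro: prod_nonneg)
  finally show ?thesis
    using assms by (simp add: sum_Pow_prod_pmf field_simps)
qed

text \<open>A value of probability 0 contributes 0 through the factor \<open>pmf p w\<close>.
  Agreement with the entropy of the library is \<open>entropy_bool\<close>.\<close>

definition bool_entropy :: "bool pmf \<Rightarrow> real" where
  "bool_entropy p = - (\<Sum>w\<in>UNIV. pmf p w * log 2 (pmf p w))"

lemma exp_linear_decay:
  fixes d :: real
  assumes "0 < d"
  shows "(\<lambda>n. exp (- real n * d)) \<longlonglongrightarrow> 0"
proof -
  have "exp (- real n * d) = exp (- d) ^ n" for n
    by (simp add: exp_of_nat_mult[symmetric] mult.commute)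
  then show ?thesis
    using assms by (simp add: LIMSEQ_realpow_zero)
qed

text \<open>The asymptotic equipartition property: the log-probability of a block is a sum of n
  i.i.d. terms of mean \<open>- bool_entropy p\<close>. A bit has only two values, so the terms are
  bounded and the tail decays exponentially.\<close>

lemma iid_atypical_tendsto:
  fixes Q :: "'x pmf" and g :: "'x \<Rightarrow> bool"
  defines "p \<equiv> map_pmf g Q"
  assumes "bool_entropy p < \<gamma>"
  shows "(\<lambda>n. measure_pmf.prob (iid n Q) {\<omega>. (\<Prod>t<n. pmf p (g (\<omega> t))) < 2 powr (- (real n * \<gamma>))})
     \<longlonglongrightarrow> 0"
proof -
  define X where "X = (\<lambda>t \<omega>. log 2 (pmf p (g ((\<omega> :: nat \<Rightarrow> 'x) t))))"
  \<comment> \<open>The summand 1 makes K positive. K is a real number even if a value has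
    probability 0, because \<open>log\<close> is total.\<close>
  define K :: real where "K = 1 + \<bar>log 2 (pmf p True)\<bar> + \<bar>log 2 (pmf p False)\<bar>"
  have bound: "\<bar>log 2 (pmf p w)\<bar> \<le> K" for w by (cases w) (auto simp: K_def)
  have le: "measure_pmf.prob (iid n Q) {\<omega>. (\<Prod>t<n. pmf p (g (\<omega> t))) < 2 powr (- (real n * \<gamma>))}
      \<le> exp (- real n * ((- bool_entropy p - (-\<gamma>))\<^sup>2 / (2 * K\<^sup>2)))" if "0 < n" for n
  proof -
    have ind: "prob_space.indep_vars (measure_pmf (iid n Q)) (\<lambda>_. borel) X {..<n}"
      unfolding X_def
      by (rule prob_space.indep_vars_compose2[OF measure_pmf.prob_space_axioms
              indep_vars_Pi_pmf[of "{..<n}" undefined "\<lambda>_. Q", folded iid_def]]) auto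
    have mu: "measure_pmf.expectation (iid n Q) (X t) = - bool_entropy p" if "t < n" for t
    proof -
      have "measure_pmf.expectation (iid n Q) (X t)
          = measure_pmf.expectation (map_pmf (\<lambda>f. f t) (iid n Q)) (\<lambda>x. log 2 (pmf p (g x)))"
        by (simp add: X_def)
      also have "map_pmf (\<lambda>f. f t) (iid n Q) = Q"
        using that by (simp add: iid_def Pi_pmf_component)
      also have "measure_pmf.expectation Q (\<lambda>x. log 2 (pmf p (g x)))
          = measure_pmf.expectation p (\<lambda>w. log 2 (pmf p w))"
        by (simp add: p_def)
      also have "\<dots> = - bool_entropy p"
        by (subst integral_measure_pmf_real[where A=UNIV]) (auto simp: bool_entropy_def mult.commute)
      finally show ?thesis .
    qed
    have "measure_pmf.prob (iid n Q) {\<omega>. (\<Prod>t<n. pmf p (g (\<omega> t))) < 2 powr (- (real n * \<gamma>))}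
        \<le> measure_pmf.prob (iid n Q) {\<omega>\<in>space (measure_pmf (iid n Q)). (\<Sum>t<n. X t \<omega>) \<le> n * (-\<gamma>)}"
    proof (rule measure_pmf.finite_measure_mono_AE)
      show "AE \<omega> in measure_pmf (iid n Q). \<omega> \<in> {\<omega>. (\<Prod>t<n. pmf p (g (\<omega> t))) < 2 powr (- (real n * \<gamma>))} \<longrightarrow>
        \<omega> \<in> {\<omega>\<in>space (measure_pmf (iid n Q)). (\<Sum>t<n. X t \<omega>) \<le> n * (-\<gamma>)}"
      \<comment> \<open>On the support every factor is positive, so the logarithm of the product
        splits into the sum.\<close>
      proof (rule AE_pmfI, clarsimp)
        fix \<omega> assume w: "\<omega> \<in> set_pmf (iid n Q)"
          and lt: "(\<Prod>t<n. pmf p (g (\<omega> t))) < 2 powr (- (real n * \<gamma>))"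
        have pos: "0 < pmf p (g (\<omega> t))" if "t < n" for t
          using w that by (auto simp: iid_def set_Pi_pmf PiE_dflt_def p_def pmf_positive)
        have "(\<Sum>t<n. X t \<omega>) = log 2 (\<Prod>t<n. pmf p (g (\<omega> t)))"
          unfolding X_def log_def using pos
          by (subst ln_prod) (auto simp: sum_divide_distrib dest: pos)
        also have "\<dots> \<le> log 2 (2 powr (- (real n * \<gamma>)))"
          using lt by (subst log_le_cancel_iff) (auto intro!: prod_pos pos)
        finally show "(\<Sum>t<n. X t \<omega>) \<le> - (real n * \<gamma>)" by simp
      qed
    qed simp
    also have "\<dots> \<le> exp (- real n * ((- bool_entropy p - (-\<gamma>))\<^sup>2 / (2 * K\<^sup>2)))"
    proof (rule measure_pmf.bounded_sum_lower_tail[OF ind _ mu])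
      show "\<bar>X i x\<bar> \<le> K" for i x unfolding X_def by (rule bound)
      show "- \<gamma> \<le> - bool_entropy p" using assms(2) by simp
      show "0 < K" by (simp add: K_def)
    qed (use that in simp_all)
    finally show ?thesis .
  qed
  have d: "0 < (- bool_entropy p - (-\<gamma>))\<^sup>2 / (2 * K\<^sup>2)"
  proof -
    have "0 < K" by (simp add: K_def)
    moreover have "- bool_entropy p - (-\<gamma>) \<noteq> 0" using assms by simp
    ultimately show ?thesis by (simp only: zero_less_power2 zero_less_divide_iff) simp
  qed
  show ?thesis
    by (rule tendsto_sandwich[OF _ _ tendsto_const exp_linear_decay[OF d]])
       (use le in \<open>auto intro: eventually_mono[OF eventually_gt_at_top[of 0]]\<close>)
qed

section \<open>Compression with a common matrix\<close>

text \<open>Each row is decoded on its own, by searching for a typical sequence with the received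
  syndrome. There are at most 2^(n \<gamma>) typical sequences, and under a uniform matrix a given
  wrong one shares the syndrome with probability 2^(-m), where m is at least n R.\<close>

lemma sw_achievable_above_entropy:
  fixes Q :: "bool list pmf"
  assumes len: "\<And>xs. xs \<in> set_pmf Q \<Longrightarrow> length xs = r"
    and ent: "\<And>a. a < r \<Longrightarrow> bool_entropy (map_pmf (\<lambda>xs. xs ! a) Q) < R"
    and R: "0 \<le> R"
  shows "sw_achievable Q r R"
  unfolding sw_achievable_def
proof (intro conjI allI impI)
  define p where "p = (\<lambda>a. map_pmf (\<lambda>xs. xs ! a) Q)"
  \<comment> \<open>\<open>R - 1\<close> keeps the set nonempty when r = 0, and lies below R, so the
    maximum still does; \<gamma> is placed halfway between them.\<close>
  define h where "h = Max (insert (R - 1) ((\<lambda>a. bool_entropy (p a)) ` {..<r}))"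
  define \<gamma> where "\<gamma> = (h + R) / 2"
  have \<gamma>: "\<gamma> < R" "a < r \<Longrightarrow> bool_entropy (p a) < \<gamma>" for a
  proof -
    have h: "h < R"
      unfolding h_def using ent by (subst Max_less_iff) (auto simp: p_def)
    then show "\<gamma> < R" by (simp add: \<gamma>_def)
    assume "a < r"
    then have "bool_entropy (p a) \<le> h"
      unfolding h_def by (intro Max_ge) auto
    with h show "bool_entropy (p a) < \<gamma>" by (simp add: \<gamma>_def)
  qed
  define atyp where "atyp = (\<lambda>n a. measure_pmf.prob (iid n Q)
     {\<omega>. (\<Prod>t<n. pmf (p a) (\<omega> t ! a)) < 2 powr (- (real n * \<gamma>))})"
  define e where "e = (\<lambda>n. (\<Sum>a<r. atyp n a) + real r * exp (- real n * ((R - \<gamma>) * ln 2)))"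
  have "e \<longlonglongrightarrow> (\<Sum>a<r. 0) + real r * 0"
    unfolding e_def atyp_def p_def
    by (intro tendsto_add tendsto_sum tendsto_mult tendsto_const exp_linear_decay iid_atypical_tendsto)
       (use \<gamma> in \<open>auto simp: p_def\<close>)
  then have e0: "e \<longlonglongrightarrow> 0" by simp
  have main: "\<exists>(B :: nat \<Rightarrow> nat \<Rightarrow> bool) (dec :: (nat \<Rightarrow> nat \<Rightarrow> bool) \<Rightarrow> nat \<Rightarrow> bool list).
        measure_pmf.prob (iid n Q)
          {\<omega>. \<exists>t<n. dec (sw_compress r (nat \<lceil>real n * R\<rceil>) n B \<omega>) t \<noteq> \<omega> t} \<le> e n" for n
  proof -
    define m where "m = nat \<lceil>real n * R\<rceil>"
    define \<theta> where "\<theta> = 2 powr (- (real n * \<gamma>))"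
    have \<theta>: "0 < \<theta>" by (simp add: \<theta>_def)
    define V where "V = (\<lambda>(\<omega> :: nat \<Rightarrow> bool list) a. {t. t < n \<and> \<omega> t ! a})"
    define tset where "tset = (\<lambda>a. {v\<in>Pow {..<n}. \<theta> \<le> (\<Prod>t<n. pmf (p a) (t \<in> v))})"
    \<comment> \<open>Some other typical sequence has the same syndrome. Agreement in all rows is
      written as a product of indicators that reaches 1, to fit the Markov bound with threshold
      1.\<close>
    define conf where "conf = (\<lambda>a (B :: nat \<Rightarrow> nat set) \<omega>. \<exists>v\<in>tset a - {V \<omega> a}.
        1 \<le> (\<Prod>b<m. of_bool (even (card (B b \<inter> sym_diff (V \<omega> a) v))) :: real))"
    have V: "V \<omega> a \<subseteq> {..<n}" for \<omega> a by (auto simp: V_def)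
    have fin: "finite (tset a)" for a by (simp add: tset_def)
    have count: "real (card {B\<in>matrices m n. conf a B \<omega>})
        \<le> real (card (matrices m n)) * exp (- real n * ((R - \<gamma>) * ln 2))" for a \<omega>
    proof -
      have "real (card {B\<in>matrices m n. conf a B \<omega>})
          \<le> card (tset a - {V \<omega> a}) * (real (card (matrices m n)) * (1/2) ^ m)"
        unfolding conf_def
      proof (rule card_ex_le)
        fix v assume v: "v \<in> tset a - {V \<omega> a}"
        then have "sym_diff (V \<omega> a) v \<subseteq> {..<n}" "sym_diff (V \<omega> a) v \<noteq> {}"
          using V[of \<omega> a] by (auto simp: tset_def)
        from card_matrices_markov[OF this, of "\<lambda>_ b. of_bool (\<not> b)" m 1]
        show "real (card {B\<in>matrices m n. 1 \<le> (\<Prod>b<m. of_bool (even (card (B b \<inter> sym_diff (V \<omega> a) v))) :: real)})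
           \<le> real (card (matrices m n)) * (1/2) ^ m"
          by simp
      qed (use fin in auto)
      also have "\<dots> \<le> (1 / \<theta>) * (real (card (matrices m n)) * (1/2) ^ m)"
      proof (rule mult_right_mono)
        have "real (card (tset a - {V \<omega> a})) \<le> real (card (tset a))"
          using fin by (simp add: card_mono)
        also have "\<dots> \<le> 1 / \<theta>" unfolding tset_def by (rule card_typical_le[OF \<theta>])
        finally show "real (card (tset a - {V \<omega> a})) \<le> 1 / \<theta>" .
      qed simp
      also have "\<dots> = real (card (matrices m n)) * ((1/2) ^ m / \<theta>)" by simp
      also have "\<dots> \<le> real (card (matrices m n)) * exp (- real n * ((R - \<gamma>) * ln 2))"
      proof (rule mult_left_mono)
        have "(1/2) ^ m = 2 powr (- real m)"
          by (simp add: powr_minus powr_realpow power_one_over field_simps)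
        also have "\<dots> \<le> 2 powr (- (real n * R))"
        proof -
          have "real n * R \<le> real m" unfolding m_def by linarith
          then show ?thesis by simp
        qed
        finally have "(1/2) ^ m / \<theta> \<le> 2 powr (- (real n * R)) / \<theta>"
          using \<theta> by (intro divide_right_mono) auto
        also have "\<dots> = 2 powr (- (real n * R) - (- (real n * \<gamma>)))"
          unfolding \<theta>_def by (rule powr_diff[symmetric])
        also have "\<dots> = exp (- real n * ((R - \<gamma>) * ln 2))"
          by (simp add: powr_def algebra_simps)
        finally show "(1/2) ^ m / \<theta> \<le> exp (- real n * ((R - \<gamma>) * ln 2))" .
      qed simp
      finally show ?thesis .
    qed
    \<comment> \<open>The confusion probabilities of all rows are added before the average is taken,
      so the matrix obtained is good for every row at once.\<close>
    have "(\<Sum>B\<in>matrices m n. \<Sum>a<r. measure_pmf.prob (iid n Q) {\<omega>. conf a B \<omega>})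
        = (\<Sum>a<r. \<Sum>B\<in>matrices m n. measure_pmf.prob (iid n Q) {\<omega>. conf a B \<omega>})"
      by (rule sum.swap)
    also have "\<dots> \<le> (\<Sum>a<r. real (card (matrices m n)) * exp (- real n * ((R - \<gamma>) * ln 2)))"
      using measure_pmf.sum_prob_le_count[where S="matrices m n", OF _ _ count]
      by (intro sum_mono) simp
    finally have "(\<Sum>B\<in>matrices m n. \<Sum>a<r. measure_pmf.prob (iid n Q) {\<omega>. conf a B \<omega>})
        \<le> real (card (matrices m n)) * (real r * exp (- real n * ((R - \<gamma>) * ln 2)))"
      by (simp add: mult_ac)
    from exists_le_average[OF finite_matrices card_matrices_pos this]
    obtain B where B: "(\<Sum>a<r. measure_pmf.prob (iid n Q) {\<omega>. conf a B \<omega>})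
        \<le> real r * exp (- real n * ((R - \<gamma>) * ln 2))"
      by blast
    define B' where "B' = (\<lambda>b t. t \<in> B b)"
    \<comment> \<open>If the true sequence is typical and not confused, it is the only one with this
      property, so the choice is determined.\<close>
    define est where "est = (\<lambda>(C :: nat \<Rightarrow> nat \<Rightarrow> bool) a. SOME v. v \<in> tset a \<and>
       (\<forall>b<m. odd (card (B b \<inter> v)) = C a b))"
    define dec where "dec = (\<lambda>C t. map (\<lambda>a. t \<in> est C a) [0..<r])"
    have dec: "dec (sw_compress r m n B' \<omega>) t = \<omega> t"
      if \<omega>: "\<omega> \<in> set_pmf (iid n Q)" and t: "t < n"
        and ok: "\<And>a. a < r \<Longrightarrow> \<not> conf a B \<omega>"
          "\<And>a. a < r \<Longrightarrow> \<not> (\<Prod>t<n. pmf (p a) (\<omega> t ! a)) < \<theta>" for \<omega> t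
    proof -
      let ?C = "sw_compress r m n B' \<omega>"
      have C: "?C a b = odd (card (B b \<inter> V \<omega> a))" if "a < r" "b < m" for a b
      proof -
        have "{t. t < n \<and> B' b t \<and> \<omega> t ! a} = B b \<inter> V \<omega> a"
          by (auto simp: B'_def V_def)
        then show ?thesis using that by (simp add: sw_compress_def)
      qed
      have est: "est ?C a = V \<omega> a" if a: "a < r" for a
        unfolding est_def
      proof (rule some_equality)
        have "(\<Prod>t<n. pmf (p a) (t \<in> V \<omega> a)) = (\<Prod>t<n. pmf (p a) (\<omega> t ! a))"
          by (intro prod.cong) (auto simp: V_def)
        then have "V \<omega> a \<in> tset a"
          using ok(2)[OF a] V by (auto simp: tset_def)
        then show "V \<omega> a \<in> tset a \<and> (\<forall>b<m. odd (card (B b \<inter> V \<omega> a)) = ?C a b)"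
          using C a by simp
      next
        fix v assume v: "v \<in> tset a \<and> (\<forall>b<m. odd (card (B b \<inter> v)) = ?C a b)"
        have fv: "finite v" "finite (V \<omega> a)"
          using v V[of \<omega> a] by (auto simp: tset_def finite_subset)
        have "even (card (B b \<inter> sym_diff (V \<omega> a) v))" if "b < m" for b
          using odd_card_sym_diff[OF fv(2,1), of "B b"] v C[OF a that] that by auto
        then have one: "(\<Prod>b<m. of_bool (even (card (B b \<inter> sym_diff (V \<omega> a) v))) :: real) = 1"
          by (intro prod.neutral) auto
        show "v = V \<omega> a"
        proof (rule ccontr)
          assume "v \<noteq> V \<omega> a"
          with v one have "conf a B \<omega>"
            unfolding conf_def by (intro bexI[of _ v]) auto
          with ok(1)[OF a] show False by simp
        qed
      qed
      have "\<omega> t \<in> set_pmf Q"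
        using \<omega> t by (auto simp: iid_def set_Pi_pmf PiE_dflt_def)
      then have l: "length (\<omega> t) = r" by (rule len)
      show ?thesis
        by (rule nth_equalityI) (use l t est in \<open>auto simp: dec_def V_def\<close>)
    qed
    have "measure_pmf.prob (iid n Q) {\<omega>. \<exists>t<n. dec (sw_compress r m n B' \<omega>) t \<noteq> \<omega> t}
       \<le> measure_pmf.prob (iid n Q) ((\<Union>a<r. {\<omega>. (\<Prod>t<n. pmf (p a) (\<omega> t ! a)) < \<theta>})
            \<union> (\<Union>a<r. {\<omega>. conf a B \<omega>}))"
    proof (rule measure_pmf.finite_measure_mono_AE)
      show "AE \<omega> in measure_pmf (iid n Q). \<omega> \<in> {\<omega>. \<exists>t<n. dec (sw_compress r m n B' \<omega>) t \<noteq> \<omega> t} \<longrightarrow>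
        \<omega> \<in> (\<Union>a<r. {\<omega>. (\<Prod>t<n. pmf (p a) (\<omega> t ! a)) < \<theta>}) \<union> (\<Union>a<r. {\<omega>. conf a B \<omega>})"
        by (rule AE_pmfI) (use dec in blast)
    qed simp
    also have "\<dots> \<le> measure_pmf.prob (iid n Q) (\<Union>a<r. {\<omega>. (\<Prod>t<n. pmf (p a) (\<omega> t ! a)) < \<theta>})
        + measure_pmf.prob (iid n Q) (\<Union>a<r. {\<omega>. conf a B \<omega>})"
      by (rule measure_Un_le) auto
    also have "\<dots> \<le> (\<Sum>a<r. measure_pmf.prob (iid n Q) {\<omega>. (\<Prod>t<n. pmf (p a) (\<omega> t ! a)) < \<theta>})
        + (\<Sum>a<r. measure_pmf.prob (iid n Q) {\<omega>. conf a B \<omega>})"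
      by (intro add_mono measure_pmf.finite_measure_subadditive_finite) auto
    also have "\<dots> \<le> e n"
      using B by (simp add: e_def atyp_def \<theta>_def)
    finally show ?thesis unfolding m_def by blast
  qed
  fix \<epsilon> :: real assume "0 < \<epsilon>"
  with e0 obtain n0 where "\<And>n. n \<ge> n0 \<Longrightarrow> e n < \<epsilon>"
    using order_tendstoD(2)[OF e0] by (auto simp: eventually_sequentially)
  then show "\<exists>n0. \<forall>n\<ge>n0. \<exists>(B :: nat \<Rightarrow> nat \<Rightarrow> bool) (dec :: (nat \<Rightarrow> nat \<Rightarrow> bool) \<Rightarrow> nat \<Rightarrow> bool list).
        measure_pmf.prob (iid n Q)
          {\<omega>. \<exists>t<n. dec (sw_compress r (nat \<lceil>real n * R\<rceil>) n B \<omega>) t \<noteq> \<omega> t} \<le> \<epsilon>"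
  proof (intro exI[of _ n0] allI impI)
    fix n assume "n0 \<le> n"
    then have "e n \<le> \<epsilon>" by (simp add: \<open>\<And>n. n \<ge> n0 \<Longrightarrow> e n < \<epsilon>\<close> less_imp_le)
    moreover obtain B and dec :: "(nat \<Rightarrow> nat \<Rightarrow> bool) \<Rightarrow> nat \<Rightarrow> bool list"
      where "measure_pmf.prob (iid n Q)
          {\<omega>. \<exists>t<n. dec (sw_compress r (nat \<lceil>real n * R\<rceil>) n B \<omega>) t \<noteq> \<omega> t} \<le> e n"
      using main[of n] by blast
    ultimately show "\<exists>(B :: nat \<Rightarrow> nat \<Rightarrow> bool) (dec :: (nat \<Rightarrow> nat \<Rightarrow> bool) \<Rightarrow> nat \<Rightarrow> bool list).
        measure_pmf.prob (iid n Q)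
          {\<omega>. \<exists>t<n. dec (sw_compress r (nat \<lceil>real n * R\<rceil>) n B \<omega>) t \<noteq> \<omega> t} \<le> \<epsilon>"
      by (intro exI[of _ B] exI[of _ dec]) linarith
  qed
qed (rule R)

section \<open>The likelihood ratio of the wrapped noise\<close>

lemma mod2_wrap_add_even: "mod2_wrap (y + 2 * of_int k) = mod2_wrap y"
proof -
  have "(y + 2 * of_int k + 1/2) / 2 = (y + 1/2) / 2 + of_int k" by (simp add: field_simps)
  then have "\<lfloor>(y + 2 * of_int k + 1/2) / 2\<rfloor> = \<lfloor>(y + 1/2) / 2\<rfloor> + k"
    by (simp only: floor_add_int)
  then show ?thesis by (simp add: mod2_wrap_def)
qed

lemma mod2_wrap_add_wrap: "mod2_wrap (x + mod2_wrap y) = mod2_wrap (x + y)"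
proof -
  have "x + mod2_wrap y = (x + y) + 2 * of_int (- \<lfloor>(y + 1/2) / 2\<rfloor>)"
    by (simp add: mod2_wrap_def)
  then show ?thesis by (simp only: mod2_wrap_add_even)
qed

lemma mod2_wrap_idem [simp]: "mod2_wrap (mod2_wrap y) = mod2_wrap y"
  using mod2_wrap_add_wrap[of 0 y] by simp

lemma mod2_wrap_add_2 [simp]: "mod2_wrap (2 + y) = mod2_wrap y"
  using mod2_wrap_add_even[of y 1] by (simp add: add.commute)

lemma mod2_wrap_add_1_1 [simp]: "mod2_wrap (1 + (1 + y)) = mod2_wrap y"
  using mod2_wrap_add_2[of y] by (simp flip: add.assoc)

lemma mod2_wrap_measurable [measurable]: "mod2_wrap \<in> borel_measurable borel"
  unfolding mod2_wrap_def by measurable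

definition bit_val :: "bool \<Rightarrow> real" where
  "bit_val w = (if w then 1 else 0)"

lemma nn_integral_count_bool_pair:
  assumes "sigma_finite_measure N" and [measurable]: "f \<in> borel_measurable (count_space UNIV \<Otimes>\<^sub>M N)"
  shows "(\<integral>\<^sup>+x. f x \<partial>(count_space (UNIV::bool set) \<Otimes>\<^sub>M N)) = (\<Sum>w\<in>UNIV. \<integral>\<^sup>+y. f (w, y) \<partial>N)"
proof -
  interpret N: sigma_finite_measure N by fact
  show ?thesis
    by (subst N.nn_integral_fst[symmetric]) (auto simp: nn_integral_count_space_finite)
qed

lemma nn_integral_pmf_bool_pair:
  fixes p :: "bool pmf"
  assumes "sigma_finite_measure N" and [measurable]: "f \<in> borel_measurable (count_space UNIV \<Otimes>\<^sub>M N)"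
  shows "(\<integral>\<^sup>+x. f x \<partial>(measure_pmf p \<Otimes>\<^sub>M N)) = (\<Sum>w\<in>UNIV. ennreal (pmf p w) * (\<integral>\<^sup>+y. f (w, y) \<partial>N))"
proof -
  interpret N: sigma_finite_measure N by fact
  have [measurable]: "f \<in> borel_measurable (measure_pmf p \<Otimes>\<^sub>M N)"
    using assms(2) by (simp cong: measurable_cong_sets sets_pair_measure_cong)
  show ?thesis
    by (subst N.nn_integral_fst[symmetric]) 
       (auto simp: nn_integral_measure_pmf nn_integral_count_space_finite)
qed

locale wrapped_noise = N: prob_space N for N :: "real measure" +
  assumes sets_N [measurable_cong]: "sets N = sets borel"
begin

definition received :: "bool \<times> real \<Rightarrow> real" where
  "received = (\<lambda>(w, z). mod2_wrap (bit_val w + z))"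

lemma received_measurable [measurable]:
  "received \<in> borel_measurable (measure_pmf p \<Otimes>\<^sub>M N)"
  "received \<in> borel_measurable (count_space UNIV \<Otimes>\<^sub>M N)"
proof -
  have "received \<in> borel_measurable (count_space UNIV \<Otimes>\<^sub>M borel)"
    unfolding received_def by measurable
  then show "received \<in> borel_measurable (measure_pmf p \<Otimes>\<^sub>M N)"
    "received \<in> borel_measurable (count_space UNIV \<Otimes>\<^sub>M N)"
    using sets_N by (simp_all cong: measurable_cong_sets sets_pair_measure_cong)
qed

definition out :: "bool pmf \<Rightarrow> real measure" where
  "out p = distr (measure_pmf p \<Otimes>\<^sub>M N) borel received"

text \<open>The output law of the uniform input serves as reference measure. It dominates the laws
  for both inputs, with densities at most 2, and is invariant under adding 1 modulo 2, which
  exchanges the inputs.\<close>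

definition ref :: "real measure" where
  "ref = out (pmf_of_set UNIV)"

lemma sets_ref [measurable_cong, simp]: "sets ref = sets borel"
  by (simp add: ref_def out_def)

sublocale ref: prob_space ref
  unfolding ref_def out_def
proof (rule prob_space.prob_space_distr)
  interpret p: pair_prob_space "measure_pmf (pmf_of_set UNIV :: bool pmf)" N
    by unfold_locales
  show "prob_space (measure_pmf (pmf_of_set UNIV :: bool pmf) \<Otimes>\<^sub>M N)"
    by unfold_locales
qed measurable

lemma nn_integral_out:
  assumes [measurable]: "f \<in> borel_measurable borel"
  shows "(\<integral>\<^sup>+y. f y \<partial>out p)
    = (\<Sum>w\<in>UNIV. ennreal (pmf p w) * (\<integral>\<^sup>+z. f (mod2_wrap (bit_val w + z)) \<partial>N))"
  unfolding out_def
  by (subst nn_integral_distr, measurable, subst nn_integral_pmf_bool_pair)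
     (auto simp: received_def N.sigma_finite_measure_axioms)

lemma nn_integral_ref:
  assumes [measurable]: "f \<in> borel_measurable borel"
  shows "(\<integral>\<^sup>+y. f y \<partial>ref) = ennreal (1/2) * (\<integral>\<^sup>+z. f (mod2_wrap (1 + z)) \<partial>N)
     + ennreal (1/2) * (\<integral>\<^sup>+z. f (mod2_wrap z) \<partial>N)"
  unfolding ref_def
  by (simp add: nn_integral_out sum_UNIV_bool bit_val_def UNIV_bool)

lemma nn_integral_ref_wrap:
  assumes [measurable]: "f \<in> borel_measurable borel"
  shows "(\<integral>\<^sup>+y. f (mod2_wrap y) \<partial>ref) = (\<integral>\<^sup>+y. f y \<partial>ref)"
  by (simp add: nn_integral_ref)

lemma nn_integral_ref_shift:
  assumes [measurable]: "f \<in> borel_measurable borel"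
  shows "(\<integral>\<^sup>+y. f (mod2_wrap (1 + y)) \<partial>ref) = (\<integral>\<^sup>+y. f y \<partial>ref)"
proof -
  have "(\<integral>\<^sup>+y. f (mod2_wrap (1 + y)) \<partial>ref) = ennreal (1/2) * (\<integral>\<^sup>+z. f (mod2_wrap z) \<partial>N)
     + ennreal (1/2) * (\<integral>\<^sup>+z. f (mod2_wrap (1 + z)) \<partial>N)"
    by (subst nn_integral_ref) (simp_all add: mod2_wrap_add_wrap)
  also have "\<dots> = (\<integral>\<^sup>+y. f y \<partial>ref)"
    by (subst nn_integral_ref[OF assms]) (rule add.commute)
  finally show ?thesis .
qed

text \<open>\<rho> is the Radon-Nikodym derivative with respect to \<open>ref\<close> of the output
  law for input 0. Since \<open>ref\<close> is the mean of the laws for the two inputs, the values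
  at y and y + 1 sum to 2 almost everywhere; the work lies in a version for which this and the
  periodicity hold everywhere.\<close>

lemma likelihood_ratio_exists:
  "\<exists>\<rho> :: real \<Rightarrow> real. \<rho> \<in> borel_measurable borel \<and> (\<forall>y. 0 \<le> \<rho> y) \<and> (\<forall>y. \<rho> y + \<rho> (y + 1) = 2)
     \<and> (\<forall>y. \<rho> (mod2_wrap y) = \<rho> y)
     \<and> (\<forall>f\<in>borel_measurable borel. (\<integral>\<^sup>+z. f (mod2_wrap z) \<partial>N) = (\<integral>\<^sup>+y. ennreal (\<rho> y) * f y \<partial>ref))"
proof -
  define \<nu> where "\<nu> = distr N borel mod2_wrap"
  have sets_\<nu>: "sets \<nu> = sets ref" by (simp add: \<nu>_def)
  have nn_\<nu>: "(\<integral>\<^sup>+y. f y \<partial>\<nu>) = (\<integral>\<^sup>+z. f (mod2_wrap z) \<partial>N)" if "f \<in> borel_measurable borel" for f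
    using that unfolding \<nu>_def by (subst nn_integral_distr) auto
  have ac: "absolutely_continuous ref \<nu>"
    unfolding absolutely_continuous_def
  proof
    fix A assume "A \<in> null_sets ref"
    then have A: "A \<in> sets borel" "(\<integral>\<^sup>+y. indicator A y \<partial>ref) = 0" by (auto simp: null_sets_def)
    \<comment> \<open>The integral over \<open>ref\<close> contains the one over \<nu> with weight
      1/2.\<close>
    then have "(\<integral>\<^sup>+y. indicator A y \<partial>\<nu>) = 0"
      using nn_integral_ref[of "indicator A"] by (auto simp: nn_\<nu>)
    then show "A \<in> null_sets \<nu>" using A by (auto simp: null_sets_def sets_\<nu>)
  qed
  define d0 where "d0 = RN_deriv ref \<nu>"
  have [measurable]: "d0 \<in> borel_measurable borel"
    using borel_measurable_RN_deriv[of ref \<nu>] unfolding d0_def by (simp cong: measurable_cong_sets)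
  have d0: "density ref d0 = \<nu>"
    unfolding d0_def by (rule ref.density_RN_deriv[OF ac sets_\<nu>])
  \<comment> \<open>Composition with the reduction makes the derivative periodic at every point; it
    remains a density because integrals over \<open>ref\<close> are unchanged by reduction.\<close>
  define d where "d = (\<lambda>y. d0 (mod2_wrap y))"
  have [measurable]: "d \<in> borel_measurable borel" unfolding d_def by measurable
  have d_wrap [simp]: "d (mod2_wrap y) = d y" for y by (simp add: d_def)
  have d1: "(\<integral>\<^sup>+z. f (mod2_wrap z) \<partial>N) = (\<integral>\<^sup>+y. d y * f y \<partial>ref)"
    if [measurable]: "f \<in> borel_measurable borel" for f
  proof -
    have "(\<integral>\<^sup>+z. f (mod2_wrap z) \<partial>N) = (\<integral>\<^sup>+y. d0 y * f y \<partial>ref)"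
      by (subst nn_\<nu>[symmetric], simp, subst d0[symmetric], subst nn_integral_density) auto
    also have "\<dots> = (\<integral>\<^sup>+y. d0 (mod2_wrap y) * f (mod2_wrap y) \<partial>ref)"
      by (subst nn_integral_ref_wrap[where f="\<lambda>y. d0 y * f y", symmetric]) auto
    also have "\<dots> = (\<integral>\<^sup>+y. d (mod2_wrap y) * f (mod2_wrap y) \<partial>ref)"
      by (simp add: d_def)
    also have "\<dots> = (\<integral>\<^sup>+y. d y * f y \<partial>ref)"
      by (rule nn_integral_ref_wrap[where f="\<lambda>y. d y * f y"]) auto
    finally show ?thesis .
  qed
  let ?T = "\<lambda>y. mod2_wrap (1 + y)"
  have TT: "?T (?T y) = mod2_wrap y" for y
    by (simp add: mod2_wrap_add_wrap)
  have d2: "(\<integral>\<^sup>+z. f (mod2_wrap (1 + z)) \<partial>N) = (\<integral>\<^sup>+y. d (1 + y) * f y \<partial>ref)"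
    if [measurable]: "f \<in> borel_measurable borel" for f
  proof -
    have "(\<integral>\<^sup>+z. f (mod2_wrap (1 + z)) \<partial>N) = (\<integral>\<^sup>+z. (\<lambda>y. f (?T y)) (mod2_wrap z) \<partial>N)"
      by (simp add: mod2_wrap_add_wrap)
    also have "\<dots> = (\<integral>\<^sup>+y. d y * f (?T y) \<partial>ref)"
      by (rule d1) measurable
    also have "\<dots> = (\<integral>\<^sup>+y. (\<lambda>y. d (?T y) * f y) (?T y) \<partial>ref)"
      by (simp only: TT d_wrap)
    also have "\<dots> = (\<integral>\<^sup>+y. d (?T y) * f y \<partial>ref)"
      by (rule nn_integral_ref_shift) measurable
    finally show ?thesis by simp
  qed
  \<comment> \<open>Both functions are densities of one measure: the mixture of the two conditional
    laws with weights 1/2 is \<open>ref\<close>.\<close>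
  have ae: "AE y in ref. ennreal (1/2) * (d (1 + y) + d y) = 1"
  proof -
    have "density ref (\<lambda>y. ennreal (1/2) * (d (1 + y) + d y)) = density ref (\<lambda>_. 1)"
    proof (rule measure_eqI)
      fix A assume "A \<in> sets (density ref (\<lambda>y. ennreal (1/2) * (d (1 + y) + d y)))"
      then have [measurable]: "A \<in> sets borel" by simp
      have "emeasure (density ref (\<lambda>y. ennreal (1/2) * (d (1 + y) + d y))) A
          = (\<integral>\<^sup>+y. ennreal (1/2) * (d (1 + y) * indicator A y) + ennreal (1/2) * (d y * indicator A y) \<partial>ref)"
        by (subst emeasure_density) (auto simp: algebra_simps)
      also have "\<dots> = ennreal (1/2) * (\<integral>\<^sup>+y. d (1 + y) * indicator A y \<partial>ref)
          + ennreal (1/2) * (\<integral>\<^sup>+y. d y * indicator A y \<partial>ref)"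
        by (subst nn_integral_add, measurable, subst (1 2) nn_integral_cmult) auto
      also have "\<dots> = (\<integral>\<^sup>+y. indicator A y \<partial>ref)"
        by (subst nn_integral_ref, simp, subst d1[of "indicator A"], simp, subst d2[of "indicator A"]) auto
      finally show "emeasure (density ref (\<lambda>y. ennreal (1/2) * (d (1 + y) + d y))) A
          = emeasure (density ref (\<lambda>_. 1)) A"
        by (simp add: emeasure_density)
    qed simp
    then show ?thesis
      by (subst (asm) ref.density_unique_iff) auto
  qed
  \<comment> \<open>The exceptional set is invariant under adding 1 and under reduction, so the
    value 1 there keeps both the sum 2 and the periodicity.\<close>
  define \<rho> where "\<rho> = (\<lambda>y. if ennreal (1/2) * (d (1 + y) + d y) = 1 then enn2real (d y) else 1)"
  have d_shift2: "d (1 + (1 + y)) = d y" for y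
    by (simp add: d_def)
  have half: "enn2real a + enn2real b = 2" if "ennreal (1/2) * (a + b) = 1" for a b
  proof -
    have "a + b \<noteq> \<infinity>" using that by (auto simp: ennreal_mult_eq_top_iff)
    then obtain x y where ab: "a = ennreal x" "b = ennreal y" "0 \<le> x" "0 \<le> y"
      by (cases a; cases b) auto
    have "ennreal ((1/2) * (x + y)) = ennreal (1/2) * (ennreal x + ennreal y)"
      using ab by (subst ennreal_mult) auto
    with that have "(1/2) * (x + y) = 1" by (simp only: ab ennreal_eq_1)
    then show ?thesis using ab by simp
  qed
  show ?thesis
  proof (intro exI[of _ \<rho>] conjI allI ballI)
    show "\<rho> \<in> borel_measurable borel" unfolding \<rho>_def by measurable
    show "0 \<le> \<rho> y" for y by (simp add: \<rho>_def)
    show "\<rho> y + \<rho> (y + 1) = 2" for y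
      using half[of "d y" "d (1 + y)"] d_shift2[of y]
      by (auto simp: \<rho>_def add.commute)
    show "\<rho> (mod2_wrap y) = \<rho> y" for y
    proof -
      have "d (1 + mod2_wrap y) = d (1 + y)" by (simp add: d_def mod2_wrap_add_wrap)
      then show ?thesis by (simp add: \<rho>_def)
    qed
    fix f :: "real \<Rightarrow> ennreal" assume [measurable]: "f \<in> borel_measurable borel"
    have "AE y in ref. d y = ennreal (\<rho> y)"
      using ae
    proof eventually_elim
      fix y assume *: "ennreal (1/2) * (d (1 + y) + d y) = 1"
      then have "d y \<noteq> \<infinity>" by (auto simp: ennreal_mult_eq_top_iff)
      with * show "d y = ennreal (\<rho> y)" by (simp add: \<rho>_def less_top)
    qed
    then show "(\<integral>\<^sup>+z. f (mod2_wrap z) \<partial>N) = (\<integral>\<^sup>+y. ennreal (\<rho> y) * f y \<partial>ref)"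
      by (subst d1, simp) (auto intro!: nn_integral_cong_AE)
  qed
qed

end

section \<open>Mutual information of the wrapped channel\<close>

lemma integral_count_bool_pair:
  fixes f :: "bool \<times> real \<Rightarrow> real"
  assumes "sigma_finite_measure N" and f: "integrable (count_space UNIV \<Otimes>\<^sub>M N) f"
  shows "(\<integral>x. f x \<partial>(count_space (UNIV::bool set) \<Otimes>\<^sub>M N)) = (\<Sum>w\<in>UNIV. \<integral>y. f (w, y) \<partial>N)"
proof -
  interpret pair_sigma_finite "count_space (UNIV::bool set)" N
    by (rule pair_sigma_finite.intro) (auto intro: assms sigma_finite_measure_count_space_finite)
  show ?thesis
    by (subst integral_fst'[OF f, symmetric]) (simp add: lebesgue_integral_count_space_finite)
qed

lemma measurable_count_bool_pair:
  assumes "\<And>w. (\<lambda>y. f (w, y)) \<in> measurable N K"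
  shows "f \<in> measurable (count_space (UNIV::bool set) \<Otimes>\<^sub>M N) K"
  by (rule measurable_pair_measure_countable1) (use assms in auto)

text \<open>\<open>ln t \<le> t - 1\<close> at t = q / x gives x ln (q / x) \<le> q - x \<le> 2, a
  bound that survives as x tends to 0.\<close>

lemma log_relative_bounds:
  fixes x q :: real
  assumes "0 \<le> x" "x \<le> q" "q \<le> 2"
  shows "- (2 / ln 2) \<le> x * log 2 (x / q)" "x * log 2 (x / q) \<le> 0"
proof -
  have "- (2 / ln 2) \<le> x * log 2 (x / q) \<and> x * log 2 (x / q) \<le> 0"
  proof (cases "x = 0")
    case False
    with assms have pos: "0 < x" "0 < q" by auto
    have "ln (x / q) \<le> 0" using pos assms by simp
    moreover have "ln (q / x) \<le> q / x - 1" using pos by (intro ln_le_minus_one) auto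
    then have "x * ln (q / x) \<le> q - x"
      using pos by (simp add: field_simps)
    then have "- 2 \<le> x * ln (x / q)"
      using pos assms by (simp add: ln_div algebra_simps)
    ultimately show ?thesis
      using pos by (simp add: log_def field_simps mult_nonneg_nonpos)
  qed simp
  then show "- (2 / ln 2) \<le> x * log 2 (x / q)" "x * log 2 (x / q) \<le> 0" by auto
qed

text \<open>After cancelling p the term is p l (log (p l / q) - log p). The first part is bounded
  independently of q because p l \<le> q, the second because p l \<le> 2. This makes information
  densities integrable.\<close>

lemma abs_information_density_le:
  fixes l q p :: real
  assumes "0 \<le> l" "l \<le> 2" "0 \<le> p" "p \<le> 1" "p * l \<le> q" "q \<le> 2"
  shows "\<bar>p * l * log 2 (p * l / (p * q))\<bar> \<le> 2 / ln 2 + 2 * \<bar>log 2 p\<bar>"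
proof (cases "p = 0 \<or> l = 0")
  case False
  with assms have pos: "0 < p" "0 < l" by auto
  then have "0 < p * l" by simp
  with assms have q: "0 < q" by linarith
  have lg: "log 2 (p * l / (p * q)) = log 2 (p * l / q) - log 2 p"
    using pos q by (simp add: log_divide log_mult)
  have eq: "p * l * log 2 (p * l / (p * q)) = p * l * log 2 (p * l / q) - p * l * log 2 p"
    by (simp only: lg right_diff_distrib)
  have "\<bar>p * l * log 2 (p * l / q)\<bar> \<le> 2 / ln 2"
    using log_relative_bounds[of "p * l" q] assms by (simp add: abs_le_iff)
  moreover have "p * l \<le> 1 * 2" by (rule mult_mono) (use assms in auto)
  then have "\<bar>p * l * log 2 p\<bar> \<le> 2 * \<bar>log 2 p\<bar>"
    using pos by (simp add: abs_mult mult_right_mono)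
  ultimately show ?thesis unfolding eq by linarith
qed auto

section \<open>The channel described by its likelihood ratio\<close>

locale noise_ratio = wrapped_noise +
  fixes \<rho> :: "real \<Rightarrow> real"
  assumes rho_measurable [measurable]: "\<rho> \<in> borel_measurable borel"
    and rho_nonneg: "\<And>y. 0 \<le> \<rho> y"
    and rho_add: "\<And>y. \<rho> y + \<rho> (y + 1) = 2"
    and rho_wrap: "\<And>y. \<rho> (mod2_wrap y) = \<rho> y"
    and rho_integral: "\<And>f. f \<in> borel_measurable borel \<Longrightarrow>
      (\<integral>\<^sup>+z. f (mod2_wrap z) \<partial>N) = (\<integral>\<^sup>+y. ennreal (\<rho> y) * f y \<partial>ref)"
begin

lemma rho_le: "\<rho> y \<le> 2"
  using rho_add[of y] rho_nonneg[of "y + 1"] by simp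

lemma rho_add_1: "\<rho> (y + 1) = 2 - \<rho> y" "\<rho> (1 + y) = 2 - \<rho> y"
  using rho_add[of y] by (simp_all add: add.commute)

text \<open>The density of the output given input w. Adding the bit is the same as subtracting it,
  as \<rho> has period 2.\<close>

definition lik :: "bool \<Rightarrow> real \<Rightarrow> real" where
  "lik w y = \<rho> (y + bit_val w)"

lemma lik_measurable [measurable]: "lik w \<in> borel_measurable borel"
  unfolding lik_def by measurable

lemma lik_nonneg: "0 \<le> lik w y" and lik_le: "lik w y \<le> 2"
  by (simp_all add: lik_def rho_nonneg rho_le)

lemma lik_False [simp]: "lik False = \<rho>"
  by (simp add: lik_def bit_val_def fun_eq_iff)

lemma lik_True: "lik True y = 2 - \<rho> y"
  by (simp add: lik_def bit_val_def rho_add_1)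

text \<open>The symmetry of the channel: the likelihood of the true input depends on the noise only,
  whichever bit was sent.\<close>

lemma lik_received: "lik w (mod2_wrap (bit_val w + z)) = \<rho> z"
  by (cases w) (simp_all add: lik_def bit_val_def rho_wrap rho_add_1)

lemma nn_integral_lik:
  assumes [measurable]: "f \<in> borel_measurable borel"
  shows "(\<integral>\<^sup>+z. f (mod2_wrap (bit_val w + z)) \<partial>N) = (\<integral>\<^sup>+y. ennreal (lik w y) * f y \<partial>ref)"
proof (cases w)
  case True
  have "(\<integral>\<^sup>+z. f (mod2_wrap (1 + z)) \<partial>N) = (\<integral>\<^sup>+z. (\<lambda>y. f (mod2_wrap (1 + y))) (mod2_wrap z) \<partial>N)"
    by (simp add: mod2_wrap_add_wrap)
  also have "\<dots> = (\<integral>\<^sup>+y. ennreal (\<rho> y) * f (mod2_wrap (1 + y)) \<partial>ref)"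
    by (rule rho_integral) measurable
  also have "\<dots> = (\<integral>\<^sup>+y. (\<lambda>y. ennreal (lik True y) * f y) (mod2_wrap (1 + y)) \<partial>ref)"
    by (simp add: lik_True rho_wrap rho_add_1)
  also have "\<dots> = (\<integral>\<^sup>+y. ennreal (lik True y) * f y \<partial>ref)"
    by (rule nn_integral_ref_shift) measurable
  finally show ?thesis using True by (simp add: bit_val_def)
qed (simp add: bit_val_def rho_integral)

lemma distr_received:
  "distr N borel (\<lambda>z. mod2_wrap (bit_val w + z)) = density ref (lik w)"
proof (rule measure_eqI)
  fix A assume "A \<in> sets (distr N borel (\<lambda>z. mod2_wrap (bit_val w + z)))"
  then have [measurable]: "A \<in> sets borel" by simp
  have "emeasure (distr N borel (\<lambda>z. mod2_wrap (bit_val w + z))) A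
      = (\<integral>\<^sup>+y. indicator A y \<partial>distr N borel (\<lambda>z. mod2_wrap (bit_val w + z)))"
    by simp
  also have "\<dots> = (\<integral>\<^sup>+z. indicator A (mod2_wrap (bit_val w + z)) \<partial>N)"
    by (rule nn_integral_distr) measurable
  also have "\<dots> = (\<integral>\<^sup>+y. ennreal (lik w y) * indicator A y \<partial>ref)"
    by (rule nn_integral_lik) measurable
  also have "\<dots> = emeasure (density ref (lik w)) A"
    by (rule emeasure_density[symmetric]) auto
  finally show "emeasure (distr N borel (\<lambda>z. mod2_wrap (bit_val w + z))) A = emeasure (density ref (lik w)) A" .
qed simp

lemma integral_lik:
  fixes G :: "real \<Rightarrow> real"
  assumes [measurable]: "G \<in> borel_measurable borel"
  shows "(\<integral>y. lik w y * G y \<partial>ref) = (\<integral>z. G (mod2_wrap (bit_val w + z)) \<partial>N)"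
proof -
  have "(\<integral>z. G (mod2_wrap (bit_val w + z)) \<partial>N) = (\<integral>y. G y \<partial>density ref (lik w))"
    unfolding distr_received[symmetric] by (rule integral_distr[symmetric]) measurable
  also have "\<dots> = (\<integral>y. lik w y * G y \<partial>ref)"
    by (subst integral_density) (auto simp: lik_nonneg)
  finally show ?thesis ..
qed

lemma integrable_ref_bounded:
  fixes G :: "real \<Rightarrow> real"
  assumes "G \<in> borel_measurable borel" "\<And>y. \<bar>G y\<bar> \<le> K"
  shows "integrable ref G"
  using assms by (intro ref.integrable_const_bound[of _ K]) (auto cong: measurable_cong_sets)

lemma integral_lik_1: "(\<integral>y. lik w y \<partial>ref) = 1"
  using integral_lik[of "\<lambda>_. 1" w] by (simp add: N.prob_space)

definition out_density :: "bool pmf \<Rightarrow> real \<Rightarrow> real" where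
  "out_density p y = (\<Sum>w\<in>UNIV. pmf p w * lik w y)"

lemma out_density_measurable [measurable]: "out_density p \<in> borel_measurable borel"
  unfolding out_density_def by measurable

lemma pmf_bool_sum: "pmf p True + pmf p False = 1"
  using sum_pmf_eq_1[of UNIV p] by (simp add: sum_UNIV_bool)

lemma out_density_bounds: "0 \<le> out_density p y" "out_density p y \<le> 2"
  and lik_le_out_density: "pmf p w * lik w y \<le> out_density p y"
proof -
  show "0 \<le> out_density p y" by (simp add: out_density_def sum_nonneg lik_nonneg)
  have "out_density p y \<le> (\<Sum>w\<in>UNIV. pmf p w * 2)"
    unfolding out_density_def by (intro sum_mono mult_left_mono lik_le) auto
  also have "\<dots> = 2" using pmf_bool_sum[of p] by (simp add: sum_UNIV_bool)
  finally show "out_density p y \<le> 2" .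
  show "pmf p w * lik w y \<le> out_density p y"
    unfolding out_density_def
    by (rule member_le_sum[of w UNIV "\<lambda>w. pmf p w * lik w y"]) (auto simp: lik_nonneg)
qed

text \<open>Marginal and joint densities over counting measure and \<open>ref\<close>, in the form
  that the formula for mutual information takes.\<close>

lemma received_distributed:
  fixes p :: "bool pmf"
  defines "M \<equiv> measure_pmf p \<Otimes>\<^sub>M N"
  shows "distributed M (count_space UNIV) fst (\<lambda>w. ennreal (pmf p w))"
    and "distributed M ref received (\<lambda>y. ennreal (out_density p y))"
    and "distributed M (count_space UNIV \<Otimes>\<^sub>M ref) (\<lambda>x. (fst x, received x))
       (\<lambda>(w, y). ennreal (pmf p w * lik w y))"
proof -
  have sM [measurable_cong]: "sets M = sets (count_space UNIV \<Otimes>\<^sub>M borel)"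
    unfolding M_def by (rule sets_pair_measure_cong) (simp_all add: sets_N)
  have nn_M: "(\<integral>\<^sup>+x. F x \<partial>M) = (\<Sum>w\<in>UNIV. ennreal (pmf p w) * (\<integral>\<^sup>+z. F (w, z) \<partial>N))"
    if "F \<in> borel_measurable M" for F
    unfolding M_def
  proof (rule nn_integral_pmf_bool_pair)
    show "F \<in> borel_measurable (count_space UNIV \<Otimes>\<^sub>M N)"
      using that sM sets_N by (simp cong: measurable_cong_sets sets_pair_measure_cong)
  qed unfold_locales
  have [measurable]: "received \<in> borel_measurable M"
    unfolding M_def by measurable
  have [measurable]: "fst \<in> measurable M (count_space UNIV)" by measurable
  show "distributed M (count_space UNIV) fst (\<lambda>w. ennreal (pmf p w))"
    unfolding distributed_def
  proof (intro conjI measure_eqI)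
    fix A assume A: "A \<in> sets (distr M (count_space UNIV) fst)"
    have "emeasure (distr M (count_space UNIV) fst) A
        = (\<integral>\<^sup>+w. indicator A w \<partial>distr M (count_space UNIV) fst)"
      using A by simp
    also have "\<dots> = (\<integral>\<^sup>+x. indicator A (fst x) \<partial>M)"
      by (rule nn_integral_distr) auto
    also have "\<dots> = (\<Sum>w\<in>UNIV. ennreal (pmf p w) * indicator A w)"
      by (subst nn_M) (auto simp: N.emeasure_space_1 intro!: measurable_compose[OF _ measurable_count_space])
    also have "\<dots> = emeasure (density (count_space UNIV) (\<lambda>w. ennreal (pmf p w))) A"
      by (simp add: emeasure_density nn_integral_count_space_finite)
    finally show "emeasure (distr M (count_space UNIV) fst) A
      = emeasure (density (count_space UNIV) (\<lambda>w. ennreal (pmf p w))) A" .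
  qed auto
  show "distributed M ref received (\<lambda>y. ennreal (out_density p y))"
    unfolding distributed_def
  proof (intro conjI measure_eqI)
    fix A assume "A \<in> sets (distr M ref received)"
    then have [measurable]: "A \<in> sets borel" by simp
    have "emeasure (distr M ref received) A = (\<integral>\<^sup>+y. indicator A y \<partial>distr M ref received)"
      by simp
    also have "\<dots> = (\<integral>\<^sup>+x. indicator A (received x) \<partial>M)"
      by (rule nn_integral_distr) auto
    also have "\<dots> = (\<Sum>w\<in>UNIV. ennreal (pmf p w) * (\<integral>\<^sup>+y. ennreal (lik w y) * indicator A y \<partial>ref))"
      by (subst nn_M) (auto simp: received_def nn_integral_lik)
    also have "\<dots> = (\<integral>\<^sup>+y. (\<Sum>w\<in>UNIV. ennreal (pmf p w) * (ennreal (lik w y) * indicator A y)) \<partial>ref)"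
      by (simp add: nn_integral_sum nn_integral_cmult)
    also have "\<dots> = (\<integral>\<^sup>+y. ennreal (out_density p y) * indicator A y \<partial>ref)"
      by (simp add: out_density_def sum_ennreal[symmetric] lik_nonneg ennreal_mult sum_distrib_right mult.assoc)
    also have "\<dots> = emeasure (density ref (\<lambda>y. ennreal (out_density p y))) A"
      by (rule emeasure_density[symmetric]) auto
    finally show "emeasure (distr M ref received) A = emeasure (density ref (\<lambda>y. ennreal (out_density p y))) A" .
  qed auto
  have [measurable]: "(\<lambda>(w, y). ennreal (pmf p w * lik w y)) \<in> borel_measurable (count_space UNIV \<Otimes>\<^sub>M ref)"
    by (rule measurable_count_bool_pair) simp
  show "distributed M (count_space UNIV \<Otimes>\<^sub>M ref) (\<lambda>x. (fst x, received x))
       (\<lambda>(w, y). ennreal (pmf p w * lik w y))"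
    unfolding distributed_def
  proof (intro conjI measure_eqI)
    fix A assume "A \<in> sets (distr M (count_space UNIV \<Otimes>\<^sub>M ref) (\<lambda>x. (fst x, received x)))"
    then have [measurable]: "A \<in> sets (count_space UNIV \<Otimes>\<^sub>M ref)" by simp
    have [measurable]: "{y. (w, y) \<in> A} \<in> sets borel" for w
      using sets_Pair1[of A "count_space UNIV" ref w] by (simp add: vimage_def)
    have ind: "indicator A (w, y) = (indicator {y. (w, y) \<in> A} y :: ennreal)" for w y
      by (simp add: indicator_def)
    have "emeasure (distr M (count_space UNIV \<Otimes>\<^sub>M ref) (\<lambda>x. (fst x, received x))) A
        = (\<integral>\<^sup>+x. indicator A x \<partial>distr M (count_space UNIV \<Otimes>\<^sub>M ref) (\<lambda>x. (fst x, received x)))"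
      by simp
    also have "\<dots> = (\<integral>\<^sup>+x. indicator A (fst x, received x) \<partial>M)"
      by (rule nn_integral_distr) auto
    also have "\<dots> = (\<Sum>w\<in>UNIV. ennreal (pmf p w) * (\<integral>\<^sup>+z. indicator {y. (w, y) \<in> A} (mod2_wrap (bit_val w + z)) \<partial>N))"
      by (subst nn_M) (auto simp: received_def ind)
    also have "\<dots> = (\<Sum>w\<in>UNIV. ennreal (pmf p w) * (\<integral>\<^sup>+y. ennreal (lik w y) * indicator {y. (w, y) \<in> A} y \<partial>ref))"
      by (simp add: nn_integral_lik)
    also have "\<dots> = (\<Sum>w\<in>UNIV. (\<integral>\<^sup>+y. ennreal (pmf p w * lik w y) * indicator {y. (w, y) \<in> A} y \<partial>ref))"
      by (intro sum.cong refl, subst nn_integral_cmult[symmetric])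
         (auto simp: ennreal_mult lik_nonneg mult.assoc)
    also have "\<dots> = (\<integral>\<^sup>+x. (case x of (w, y) \<Rightarrow> ennreal (pmf p w * lik w y)) * indicator A x \<partial>(count_space UNIV \<Otimes>\<^sub>M ref))"
      by (subst nn_integral_count_bool_pair) (auto simp: ind ref.sigma_finite_measure_axioms)
    also have "\<dots> = emeasure (density (count_space UNIV \<Otimes>\<^sub>M ref) (\<lambda>(w, y). ennreal (pmf p w * lik w y))) A"
      by (rule emeasure_density[symmetric]) auto
    finally show "emeasure (distr M (count_space UNIV \<Otimes>\<^sub>M ref) (\<lambda>x. (fst x, received x))) A
      = emeasure (density (count_space UNIV \<Otimes>\<^sub>M ref) (\<lambda>(w, y). ennreal (pmf p w * lik w y))) A" .
  qed auto
qed

definition info :: "bool pmf \<Rightarrow> real" where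
  "info p = prob_space.mutual_information (measure_pmf p \<Otimes>\<^sub>M N) 2 (count_space UNIV) borel fst received"

lemma info_eq:
  "info p = (\<Sum>w\<in>UNIV. \<integral>y. pmf p w * lik w y * log 2 (pmf p w * lik w y / (pmf p w * out_density p y)) \<partial>ref)"
proof -
  interpret p: pair_prob_space "measure_pmf p" N by unfold_locales
  interpret I: information_space "measure_pmf p \<Otimes>\<^sub>M N" 2 by unfold_locales simp
  let ?M = "measure_pmf p \<Otimes>\<^sub>M N"
  let ?f = "\<lambda>x. (\<lambda>(w, y). pmf p w * lik w y) x * log 2 ((\<lambda>(w, y). pmf p w * lik w y) x / (pmf p (fst x) * out_density p (snd x)))"
  \<comment> \<open>Mutual information uses the target spaces only through their sigma-algebras, so
    \<open>borel\<close> may be replaced by \<open>ref\<close>, against which the densities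
    exist.\<close>
  have "info p = p.mutual_information 2 (count_space UNIV) ref fst received"
    unfolding info_def p.mutual_information_def
    by (intro arg_cong2[where f="KL_divergence 2"] arg_cong2[where f=pair_measure] distr_cong
        sets_pair_measure_cong) auto
  also have "\<dots> = (\<integral>x. ?f x \<partial>(count_space UNIV \<Otimes>\<^sub>M ref))"
    by (rule I.mutual_information_distr)
       (use received_distributed[of p] in \<open>auto simp: sigma_finite_measure_count_space_finite
         ref.sigma_finite_measure_axioms out_density_bounds lik_nonneg split_def\<close>)
  also have "\<dots> = (\<Sum>w\<in>UNIV. \<integral>y. ?f (w, y) \<partial>ref)"
  proof (rule integral_count_bool_pair)
    interpret C: finite_measure "count_space (UNIV :: bool set) \<Otimes>\<^sub>M ref"
      by (rule finite_measure_pair_measure) (auto intro: finite_measure_count_space ref.finite_measure_axioms)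
    show "integrable (count_space UNIV \<Otimes>\<^sub>M ref) ?f"
    proof (rule C.integrable_const_bound)
      have "norm (?f (w, y)) \<le> 2 / ln 2 + 2 * (\<bar>log 2 (pmf p True)\<bar> + \<bar>log 2 (pmf p False)\<bar>)" for w y
      proof -
        have "norm (?f (w, y)) \<le> 2 / ln 2 + 2 * \<bar>log 2 (pmf p w)\<bar>"
          unfolding prod.case fst_conv snd_conv real_norm_def
          by (rule abs_information_density_le)
             (simp_all add: lik_nonneg lik_le pmf_le_1 lik_le_out_density out_density_bounds)
        also have "\<dots> \<le> 2 / ln 2 + 2 * (\<bar>log 2 (pmf p True)\<bar> + \<bar>log 2 (pmf p False)\<bar>)"
          by (cases w) simp_all
        finally show ?thesis .
      qed
      then show "AE x in count_space UNIV \<Otimes>\<^sub>M ref.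
          norm (?f x) \<le> 2 / ln 2 + 2 * (\<bar>log 2 (pmf p True)\<bar> + \<bar>log 2 (pmf p False)\<bar>)"
        by auto
      show "?f \<in> borel_measurable (count_space UNIV \<Otimes>\<^sub>M ref)"
        by (rule measurable_count_bool_pair) simp
    qed
  qed unfold_locales
  finally show ?thesis by simp
qed

end

section \<open>Bounds on the mutual information\<close>

lemma abs_log2_le:
  fixes l \<epsilon> :: real
  assumes "0 < \<epsilon>" "\<epsilon> \<le> l" "l \<le> 2"
  shows "\<bar>log 2 l\<bar> \<le> \<bar>log 2 \<epsilon>\<bar> + 1"
proof -
  have "log 2 \<epsilon> \<le> log 2 l" using assms by simp
  moreover have "log 2 l \<le> log 2 2" using assms by (subst log_le_cancel_iff) auto
  ultimately show ?thesis by simp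
qed

context noise_ratio
begin

text \<open>The constant 1 also has values at y and y + 1 that sum to 2, so the mixture inherits
  this identity.\<close>

definition smooth :: "real \<Rightarrow> real \<Rightarrow> real" where
  "smooth \<epsilon> y = (1 - \<epsilon>) * \<rho> y + \<epsilon>"

lemma smooth_bounds:
  assumes "0 < \<epsilon>" "\<epsilon> < 1"
  shows "\<epsilon> \<le> smooth \<epsilon> y" "smooth \<epsilon> y \<le> 2"
proof -
  show "\<epsilon> \<le> smooth \<epsilon> y" using assms by (simp add: smooth_def rho_nonneg)
  have "(1 - \<epsilon>) * \<rho> y \<le> (1 - \<epsilon>) * 2"
    using assms by (intro mult_left_mono rho_le) auto
  then show "smooth \<epsilon> y \<le> 2" using assms by (simp add: smooth_def)
qed

lemma smooth_measurable [measurable]: "smooth \<epsilon> \<in> borel_measurable borel"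
  unfolding smooth_def by measurable

text \<open>Replacing the output density of p by the constant 1 can only increase the information,
  by a relative entropy. What remains is the divergence of \<open>lik w\<close> from 1, equal for
  both w. As the mixture is at least (1 - \<epsilon>) times the likelihood, using it instead costs
  \<open>- log 2 (1 - \<epsilon>)\<close>. The bound is uniform in p and so passes to the
  supremum.\<close>

lemma info_le:
  assumes \<epsilon>: "0 < \<epsilon>" "\<epsilon> < 1"
  shows "info p \<le> (\<integral>z. log 2 (smooth \<epsilon> z) \<partial>N) - log 2 (1 - \<epsilon>)"
proof -
  define \<kappa> where "\<kappa> = log 2 (1 - \<epsilon>)"
  let ?q = "out_density p"
  define sm where "sm = (\<lambda>w y. (1 - \<epsilon>) * lik w y + \<epsilon>)"
  have [measurable]: "sm w \<in> borel_measurable borel" for w unfolding sm_def by measurable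
  have sm: "\<epsilon> \<le> sm w y" "sm w y \<le> 2" for w y
  proof -
    have "sm w y = smooth \<epsilon> (y + bit_val w)" by (simp add: sm_def smooth_def lik_def)
    then show "\<epsilon> \<le> sm w y" "sm w y \<le> 2" using smooth_bounds[OF \<epsilon>] by simp_all
  qed
  define f where "f = (\<lambda>w y. pmf p w * lik w y * log 2 (pmf p w * lik w y / (pmf p w * ?q y)))"
  define g where "g = (\<lambda>w y. lik w y * (log 2 (sm w y) - \<kappa>))"
  \<comment> \<open>The negative of d is the bound 1 / q - 1 on ln (1 / q), weighted by the joint
    density. Summed over w, d is at least q - 1, whose integral is 0.\<close>
  define d where "d = (\<lambda>w y. pmf p w * lik w y - pmf p w * lik w y / ?q y)"
  have [measurable]: "f w \<in> borel_measurable borel" "g w \<in> borel_measurable borel"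
    "d w \<in> borel_measurable borel" for w
    unfolding f_def g_def d_def by measurable
  have pl: "0 \<le> pmf p w * lik w y" "pmf p w * lik w y \<le> 2" for w y
    using lik_le_out_density[of p w y] out_density_bounds[of p y] lik_nonneg[of w y]
    by (auto intro: order_trans)
  have int_f: "integrable ref (f w)" for w
  proof (rule integrable_ref_bounded)
    show "\<bar>f w y\<bar> \<le> 2 / ln 2 + 2 * \<bar>log 2 (pmf p w)\<bar>" for y
      unfolding f_def
      by (rule abs_information_density_le)
         (simp_all add: lik_nonneg lik_le pmf_le_1 lik_le_out_density out_density_bounds)
  qed simp
  have int_g: "integrable ref (g w)" for w
  proof (rule integrable_ref_bounded)
    show "\<bar>g w y\<bar> \<le> 2 * (\<bar>log 2 \<epsilon>\<bar> + 1 + \<bar>\<kappa>\<bar>)" for y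
      unfolding g_def abs_mult
      using abs_log2_le[OF \<epsilon>(1) sm, of w y] lik_nonneg[of w y] lik_le[of w y]
      by (intro mult_mono) auto
  qed simp
  have int_d: "integrable ref (d w)" for w
  proof (rule integrable_ref_bounded)
    show "\<bar>d w y\<bar> \<le> 3" for y
    proof -
      have "0 \<le> pmf p w * lik w y / ?q y" "pmf p w * lik w y / ?q y \<le> 1"
        using lik_le_out_density[of p w y] out_density_bounds(1)[of p y] lik_nonneg[of w y]
        by (auto simp: divide_le_eq_1)
      with pl[of w y] show ?thesis unfolding d_def by linarith
    qed
  qed simp
  have pointwise: "f w y \<le> pmf p w * g w y - d w y / ln 2" for w y
  proof (cases "pmf p w * lik w y = 0")
    case True
    then show ?thesis by (auto simp: f_def g_def d_def)
  next
    case False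
    with pl[of w y] have pos: "0 < pmf p w" "0 < lik w y"
      by (auto simp: less_le lik_nonneg)
    then have "0 < pmf p w * lik w y" by simp
    with lik_le_out_density[of p w y] have q: "0 < ?q y" by linarith
    have "(1 - \<epsilon>) * lik w y \<le> sm w y" using \<epsilon> by (simp add: sm_def)
    then have "log 2 ((1 - \<epsilon>) * lik w y) \<le> log 2 (sm w y)"
      using \<epsilon> pos by (subst log_le_cancel_iff) (auto intro: order.strict_trans2[OF _ sm(1)])
    then have 1: "log 2 (lik w y) \<le> log 2 (sm w y) - \<kappa>"
      using \<epsilon> pos by (simp add: log_mult \<kappa>_def)
    have "ln (1 / ?q y) \<le> 1 / ?q y - 1"
      using q by (intro ln_le_minus_one) auto
    then have "(- ln (?q y)) / ln 2 \<le> (1 / ?q y - 1) / ln 2"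
      using q by (intro divide_right_mono) (auto simp: ln_div)
    then have "- log 2 (?q y) \<le> (1 / ?q y - 1) / ln 2"
      by (simp add: log_def)
    with 1 have "log 2 (lik w y / ?q y) \<le> log 2 (sm w y) - \<kappa> + (1 / ?q y - 1) / ln 2"
      using pos q by (simp add: log_divide)
    then have "pmf p w * lik w y * log 2 (lik w y / ?q y)
        \<le> pmf p w * lik w y * (log 2 (sm w y) - \<kappa> + (1 / ?q y - 1) / ln 2)"
      using pos by (intro mult_left_mono) auto
    also have "\<dots> = pmf p w * g w y - d w y / ln 2"
      by (simp add: g_def d_def algebra_simps diff_divide_distrib)
    finally show ?thesis using pos by (simp add: f_def)
  qed
  have "info p = (\<Sum>w\<in>UNIV. \<integral>y. f w y \<partial>ref)"
    by (simp add: info_eq f_def)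
  also have "\<dots> \<le> (\<Sum>w\<in>UNIV. \<integral>y. pmf p w * g w y - d w y / ln 2 \<partial>ref)"
    by (intro sum_mono integral_mono pointwise int_f Bochner_Integration.integrable_diff
        integrable_mult_right integrable_divide int_g int_d)
  also have "\<dots> = (\<Sum>w\<in>UNIV. pmf p w * (\<integral>y. g w y \<partial>ref)) - (\<Sum>w\<in>UNIV. \<integral>y. d w y \<partial>ref) / ln 2"
    by (simp add: Bochner_Integration.integral_diff int_g int_d sum_subtractf sum_divide_distrib)
  also have "(\<Sum>w\<in>UNIV. pmf p w * (\<integral>y. g w y \<partial>ref)) = (\<integral>z. log 2 (smooth \<epsilon> z) \<partial>N) - \<kappa>"
  proof -
    have "(\<integral>y. g w y \<partial>ref) = (\<integral>z. log 2 (smooth \<epsilon> z) \<partial>N) - \<kappa>" for w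
    proof -
      have "(\<integral>y. g w y \<partial>ref) = (\<integral>z. log 2 (sm w (mod2_wrap (bit_val w + z))) - \<kappa> \<partial>N)"
        unfolding g_def by (rule integral_lik) measurable
      also have "\<dots> = (\<integral>z. log 2 (smooth \<epsilon> z) - \<kappa> \<partial>N)"
        by (simp add: sm_def lik_received smooth_def)
      also have "\<dots> = (\<integral>z. log 2 (smooth \<epsilon> z) \<partial>N) - \<kappa>"
      proof (subst Bochner_Integration.integral_diff)
        show "integrable N (\<lambda>z. log 2 (smooth \<epsilon> z))"
          by (rule N.integrable_const_bound[of _ "\<bar>log 2 \<epsilon>\<bar> + 1"])
             (auto intro!: abs_log2_le[OF \<epsilon>(1)] smooth_bounds \<epsilon> simp: real_norm_def
               simp del: abs_le_iff)
      qed (simp_all add: N.prob_space)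
      finally show ?thesis .
    qed
    then show ?thesis using pmf_bool_sum[of p]
      by (simp add: sum_UNIV_bool flip: distrib_right)
  qed
  also have "\<dots> - (\<Sum>w\<in>UNIV. \<integral>y. d w y \<partial>ref) / ln 2 \<le> (\<integral>z. log 2 (smooth \<epsilon> z) \<partial>N) - \<kappa>"
  proof -
    have int_q: "integrable ref ?q"
      by (rule integrable_ref_bounded[of _ 2]) (auto simp: out_density_bounds)
    have "(\<integral>y. ?q y \<partial>ref) = (\<Sum>w\<in>UNIV. \<integral>y. pmf p w * lik w y \<partial>ref)"
      unfolding out_density_def
      by (rule Bochner_Integration.integral_sum, rule integrable_mult_right,
          rule integrable_ref_bounded[of _ 2]) (auto simp: lik_nonneg lik_le)
    also have "\<dots> = 1" using pmf_bool_sum[of p] by (simp add: integral_lik_1 sum_UNIV_bool)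
    finally have q1: "(\<integral>y. ?q y \<partial>ref) = 1" .
    have "0 = (\<integral>y. ?q y - 1 \<partial>ref)"
      by (simp add: q1 int_q ref.prob_space)
    also have "\<dots> \<le> (\<integral>y. (\<Sum>w\<in>UNIV. d w y) \<partial>ref)"
    proof (rule integral_mono)
      fix y
      have "(\<Sum>w\<in>UNIV. d w y) = ?q y - ?q y / ?q y"
        by (simp add: d_def sum_subtractf out_density_def flip: sum_divide_distrib)
      \<comment> \<open>Where q vanishes, the quotient is 0 and the inequality reads -1 \<le>
        0.\<close>
      then show "?q y - 1 \<le> (\<Sum>w\<in>UNIV. d w y)" by (cases "?q y = 0") auto
    qed (use int_q int_d in auto)
    also have "\<dots> = (\<Sum>w\<in>UNIV. \<integral>y. d w y \<partial>ref)"
      by (rule Bochner_Integration.integral_sum) (rule int_d)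
    finally show ?thesis by simp
  qed
  finally show ?thesis by (simp add: \<kappa>_def)
qed

text \<open>For uniform input the output density is 1, and the information is a positive multiple of
  the sum of two divergences, integrals of l ln l - l + 1 \<ge> 0. If the one for input 0 vanished,
  \<rho> would be 1 almost everywhere and both inputs would give the same output law.\<close>

lemma info_uniform_pos:
  assumes ne: "distr N borel (\<lambda>z. mod2_wrap z) \<noteq> distr N borel (\<lambda>z. mod2_wrap (1 + z))"
  shows "0 < info (pmf_of_set UNIV)"
proof -
  define J where "J = (\<lambda>w. \<integral>y. lik w y * ln (lik w y) \<partial>ref)"
  define k where "k = (\<lambda>w y. lik w y * ln (lik w y) - lik w y + 1)"
  have ln_bounds: "l - 1 \<le> l * ln l" "l * ln l \<le> 2" if "0 \<le> l" "l \<le> 2" for l :: real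
  proof -
    show "l - 1 \<le> l * ln l"
    proof (cases "l = 0")
      case False
      have "ln (1 / l) \<le> 1 / l - 1" using False that by (intro ln_le_minus_one) auto
      then show ?thesis using False that by (simp add: ln_div field_simps)
    qed simp
    show "l * ln l \<le> 2"
    proof (cases "l = 0")
      case False
      have "ln l \<le> l - 1" using False that by (intro ln_le_minus_one) auto
      then have "l * ln l \<le> l * 1" using that by (intro mult_left_mono) auto
      then show ?thesis using that by simp
    qed simp
  qed
  have int_l: "integrable ref (lik w)" for w
    by (rule integrable_ref_bounded[of _ 2]) (auto simp: lik_nonneg lik_le)
  have int_ll: "integrable ref (\<lambda>y. lik w y * ln (lik w y))" for w
  proof (rule integrable_ref_bounded)
    show "\<bar>lik w y * ln (lik w y)\<bar> \<le> 2" for y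
      using ln_bounds[OF lik_nonneg[of w y] lik_le[of w y]] lik_nonneg[of w y] by linarith
  qed simp
  have int_k: "integrable ref (k w)" for w
    unfolding k_def using int_l int_ll by simp
  have k_nonneg: "0 \<le> k w y" for w y
    using ln_bounds[OF lik_nonneg[of w y] lik_le[of w y]] by (simp add: k_def)
  have J_k: "(\<integral>y. k w y \<partial>ref) = J w" for w
    unfolding k_def J_def using int_l int_ll by (simp add: integral_lik_1 ref.prob_space)
  have J_nonneg: "0 \<le> J w" for w
    unfolding J_k[symmetric] by (rule integral_nonneg_AE) (simp add: k_nonneg)
  have "J False \<noteq> 0"
  proof
    assume "J False = 0"
    then have "AE y in ref. k False y = 0"
      using integral_nonneg_eq_0_iff_AE[OF int_k, of False] J_k[of False] k_nonneg by simp
    then have ae: "AE y in ref. \<rho> y = 1"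
    proof eventually_elim
      fix y assume k0: "k False y = 0"
      have "\<rho> y \<noteq> 0" using k0 by (auto simp: k_def)
      then have pos: "0 < \<rho> y" using rho_nonneg[of y] by simp
      have "ln (1 / \<rho> y) = 1 / \<rho> y - 1"
        using k0 pos by (simp add: k_def ln_div field_simps)
      then have "1 / \<rho> y = 1" using pos by (intro ln_eq_minus_one) auto
      then show "\<rho> y = 1" using pos by simp
    qed
    have "density ref (lik False) = density ref (lik True)"
      by (rule density_cong) (use ae in \<open>auto simp: lik_True\<close>)
    then show False
      using ne distr_received[of False] distr_received[of True] by (simp add: bit_val_def)
  qed
  then have "0 < J False" using J_nonneg[of False] by simp
  have q: "out_density (pmf_of_set UNIV) y = 1" for y
    by (simp add: out_density_def sum_UNIV_bool lik_True UNIV_bool field_simps)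
  have "info (pmf_of_set UNIV) = (\<Sum>w\<in>UNIV. J w / (2 * ln 2))"
    unfolding info_eq J_def q
    by (intro sum.cong refl, subst integral_divide_zero[symmetric])
       (simp add: UNIV_bool log_def)
  with \<open>0 < J False\<close> J_nonneg[of True] show ?thesis
    by (simp add: sum_UNIV_bool add_nonneg_pos)
qed

end

section \<open>Gaussian noise\<close>

abbreviation gauss :: "real \<Rightarrow> real measure" where
  "gauss s \<equiv> density lborel (\<lambda>z. ennreal (normal_density 0 s z))"

lemma cos_pi_mod2_wrap: "cos (pi * mod2_wrap y) = cos (pi * y)"
proof -
  have "cos (pi * mod2_wrap y) = cos (pi * y + of_int (- \<lfloor>(y + 1/2) / 2\<rfloor>) * (2 * pi))"
    by (simp add: mod2_wrap_def algebra_simps)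
  also have "\<dots> = cos (pi * y)"
    using cos_int_2pin[of "\<lfloor>(y + 1/2) / 2\<rfloor>"] sin_int_2pin[of "\<lfloor>(y + 1/2) / 2\<rfloor>"]
    by (simp add: cos_add cos_diff mult.commute)
  finally show ?thesis .
qed

text \<open>The real part of the characteristic function at pi, read off from the standard normal
  law by scaling.\<close>

lemma integral_cos_gauss:
  assumes s: "0 < s"
  shows "(\<integral>z. cos (pi * z) \<partial>gauss s) = exp (- (pi * s)\<^sup>2 / 2)"
proof -
  interpret S: real_distribution std_normal_distribution
    by (rule real_dist_normal_dist)
  have "distributed std_normal_distribution lborel (\<lambda>x. x) std_normal_density"
    by (auto simp: distributed_def distr_id2)
  from S.normal_density_affine[OF this, of s 0] s
  have "distributed std_normal_distribution lborel (\<lambda>x. s * x) (normal_density 0 s)"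
    by simp
  then have "gauss s = distr std_normal_distribution lborel (\<lambda>x. s * x)"
    by (simp add: distributed_def)
  then have "(\<integral>z. cos (pi * z) \<partial>gauss s) = (\<integral>x. cos (pi * (s * x)) \<partial>std_normal_distribution)"
    by (simp add: integral_distr)
  also have "\<dots> = (\<integral>x. Re (iexp (pi * s * x)) \<partial>std_normal_distribution)"
    by (simp add: Re_exp mult.assoc)
  also have "\<dots> = Re (char std_normal_distribution (pi * s))"
    unfolding char_def by (rule integral_Re) (rule S.integrable_iexp, simp_all only: measurable_ident_sets Im_complex_of_real, simp)
  also have "\<dots> = exp (- (pi * s)\<^sup>2 / 2)"
    by (simp add: char_std_normal_distribution)
  finally show ?thesis .
qed

lemma gauss_ratio_exists:
  assumes s: "0 < s"
  obtains \<rho> where "noise_ratio (gauss s) \<rho>"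
proof -
  interpret prob_space "gauss s" by (rule prob_space_normal_density[OF s])
  interpret wrapped_noise "gauss s" by unfold_locales simp
  from likelihood_ratio_exists obtain \<rho> where "noise_ratio_axioms (gauss s) \<rho>"
    unfolding noise_ratio_axioms_def by blast
  then show ?thesis
    by (intro that noise_ratio.intro wrapped_noise_axioms)
qed

text \<open>cos (pi y) has period 2, so reduction leaves it unchanged, but it changes sign when 1 is
  added. Equal laws would force its mean to be 0, whereas the mean is a value of the exponential
  function.\<close>

lemma gauss_wrap_shift_neq:
  assumes s: "0 < s"
  shows "distr (gauss s) borel (\<lambda>z. mod2_wrap z) \<noteq> distr (gauss s) borel (\<lambda>z. mod2_wrap (1 + z))"
proof
  assume "distr (gauss s) borel (\<lambda>z. mod2_wrap z) = distr (gauss s) borel (\<lambda>z. mod2_wrap (1 + z))"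
  then have "(\<integral>y. cos (pi * y) \<partial>distr (gauss s) borel (\<lambda>z. mod2_wrap z))
     = (\<integral>y. cos (pi * y) \<partial>distr (gauss s) borel (\<lambda>z. mod2_wrap (1 + z)))"
    by simp
  then have "(\<integral>z. cos (pi * mod2_wrap z) \<partial>gauss s) = (\<integral>z. cos (pi * mod2_wrap (1 + z)) \<partial>gauss s)"
    by (simp add: integral_distr)
  then have "(\<integral>z. cos (pi * z) \<partial>gauss s) = (\<integral>z. - cos (pi * z) \<partial>gauss s)"
    by (simp only: cos_pi_mod2_wrap) (simp add: distrib_left cos_add)
  then show False by (simp add: integral_cos_gauss[OF s])
qed

lemma mod_channel_capacity_eq_info:
  assumes "noise_ratio (gauss s) \<rho>"
  shows "mod_channel_capacity s = (SUP p. noise_ratio.info (gauss s) p)"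
proof -
  interpret noise_ratio "gauss s" \<rho> by fact
  show ?thesis
    unfolding mod_channel_capacity_def info_def received_def bit_val_def by simp
qed

lemma mod_channel_capacity_pos:
  assumes s: "0 < s"
  shows "0 < mod_channel_capacity s"
proof -
  obtain \<rho> where "noise_ratio (gauss s) \<rho>" by (rule gauss_ratio_exists[OF s])
  then interpret noise_ratio "gauss s" \<rho> .
  have "0 < info (pmf_of_set UNIV)"
    by (rule info_uniform_pos[OF gauss_wrap_shift_neq[OF s]])
  \<comment> \<open>The supremum must be known to be bounded; any fixed mixing weight gives a bound,
    here 1/2.\<close>
  also have "\<dots> \<le> (SUP p. info p)"
    using info_le[of "1/2"] by (intro cSUP_upper bdd_aboveI2) auto
  finally show ?thesis
    using mod_channel_capacity_eq_info[OF noise_ratio_axioms] by simp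
qed

lemma decoding_metric_exists:
  assumes s: "0 < s" and \<gamma>: "\<gamma> < mod_channel_capacity s"
  obtains \<psi> \<epsilon> where "\<psi> \<in> borel_measurable borel" "0 < \<epsilon>" "\<And>y. \<epsilon> \<le> \<psi> y" "\<And>y. \<psi> y \<le> 2"
    "\<And>y. \<psi> y + \<psi> (y + 1) = 2" "\<gamma> < (\<integral>z. log 2 (\<psi> z) \<partial>gauss s)"
proof -
  obtain \<rho> where "noise_ratio (gauss s) \<rho>" by (rule gauss_ratio_exists[OF s])
  then interpret noise_ratio "gauss s" \<rho> .
  define \<delta> where "\<delta> = (mod_channel_capacity s - \<gamma>) / 2"
  \<comment> \<open>Chosen so that \<open>- log 2 (1 - \<epsilon>)\<close> equals \<delta>: mixing
    costs at most half the distance from \<gamma> to the capacity.\<close>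
  define \<epsilon> where "\<epsilon> = 1 - 2 powr (- \<delta>)"
  have \<delta>: "0 < \<delta>" using \<gamma> by (simp add: \<delta>_def)
  then have \<epsilon>: "0 < \<epsilon>" "\<epsilon> < 1" by (simp_all add: \<epsilon>_def powr_less_one)
  have "mod_channel_capacity s \<le> (\<integral>z. log 2 (smooth \<epsilon> z) \<partial>gauss s) - log 2 (1 - \<epsilon>)"
    unfolding mod_channel_capacity_eq_info[OF noise_ratio_axioms]
    by (rule cSUP_least) (auto intro: info_le[OF \<epsilon>])
  also have "log 2 (1 - \<epsilon>) = - \<delta>" by (simp add: \<epsilon>_def)
  finally have "\<gamma> < (\<integral>z. log 2 (smooth \<epsilon> z) \<partial>gauss s)"
    using \<delta> by (simp add: \<delta>_def field_simps)
  moreover have "smooth \<epsilon> y + smooth \<epsilon> (y + 1) = 2" for y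
    by (simp add: smooth_def rho_add_1 algebra_simps)
  ultimately show ?thesis
    using that[of "smooth \<epsilon>" \<epsilon>] smooth_bounds[OF \<epsilon>] \<epsilon> by simp
qed

section \<open>Block averages of the noise\<close>

text \<open>The joint law of the coordinates is the product measure itself, and each marginal is
  D.\<close>

lemma indep_vars_PiM_components:
  fixes D :: "real measure"
  assumes D: "prob_space D" "sets D = sets borel" and "I \<noteq> {}"
  shows "prob_space.indep_vars (PiM I (\<lambda>_. D)) (\<lambda>_. borel) (\<lambda>i x. x i) I"
proof -
  interpret product_prob_space "\<lambda>_. D" I
    by (rule product_prob_spaceI) (rule D)
  have s [measurable_cong]: "sets (PiM I (\<lambda>_. D)) = sets (PiM I (\<lambda>_. borel))"
    by (rule sets_PiM_cong) (simp_all add: D)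
  have comp: "distr (PiM I (\<lambda>_. D)) borel (\<lambda>x. x i) = D" if "i \<in> I" for i
  proof -
    have "distr (PiM I (\<lambda>_. D)) borel (\<lambda>x. x i) = distr (PiM I (\<lambda>_. D)) D (\<lambda>x. x i)"
      by (rule distr_cong) (simp_all add: D)
    then show ?thesis using PiM_component[OF that] by simp
  qed
  have "distr (PiM I (\<lambda>_. D)) (PiM I (\<lambda>_. borel)) (\<lambda>x. \<lambda>i\<in>I. x i)
      = distr (PiM I (\<lambda>_. D)) (PiM I (\<lambda>_. D)) (\<lambda>x. x)"
    by (rule distr_cong) (auto simp: s space_PiM PiE_restrict)
  also have "\<dots> = PiM I (\<lambda>_. D)" by (simp add: distr_id2)
  also have "\<dots> = PiM I (\<lambda>i. distr (PiM I (\<lambda>_. D)) borel (\<lambda>x. x i))"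
    by (rule PiM_cong) (simp_all add: comp)
  finally have eq: "distr (PiM I (\<lambda>_. D)) (PiM I (\<lambda>_. borel)) (\<lambda>x. \<lambda>i\<in>I. x i)
      = PiM I (\<lambda>i. distr (PiM I (\<lambda>_. D)) borel (\<lambda>x. x i))" .
  have "(\<lambda>x. x i) \<in> borel_measurable (PiM I (\<lambda>_. D))" if "i \<in> I" for i
    using that s by (auto cong: measurable_cong_sets)
  with eq show ?thesis
    by (intro iffD2[OF P.indep_vars_iff_distr_eq_PiM'[OF \<open>I \<noteq> {}\<close>]])
qed

text \<open>Bit m occupies the N positions from m N on; within these, row a owns the w positions
  from a w on.\<close>

definition block_avg :: "nat \<Rightarrow> nat \<Rightarrow> nat \<Rightarrow> nat \<Rightarrow> (nat \<Rightarrow> real) \<Rightarrow> real" where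
  "block_avg N w a m y = (\<Sum>q<w. y (m * N + (a * w + q))) / real w"

lemma block_index_less:
  fixes a r w q N m n :: nat
  assumes "a < r" "r * w \<le> N" "q < w"
  shows "a * w + q < r * w" "a * w + q < N" "m < n \<Longrightarrow> m * N + (a * w + q) < n * N"
proof -
  have "a * w + q < (a + 1) * w" using assms by simp
  also have "\<dots> \<le> r * w" using assms by (intro mult_right_mono) auto
  finally show "a * w + q < r * w" .
  with assms show *: "a * w + q < N" by simp
  assume "m < n"
  have "m * N + (a * w + q) < (m + 1) * N" using * by simp
  also have "\<dots> \<le> n * N" using \<open>m < n\<close> by (intro mult_right_mono) auto
  finally show "m * N + (a * w + q) < n * N" .
qed

lemma sets_cdma_noise: "sets (cdma_noise \<sigma> len) = sets (PiM {..<len} (\<lambda>_. borel))"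
  unfolding cdma_noise_def by (rule sets_PiM_cong) simp_all

lemma prob_space_cdma_noise: "0 < \<sigma> \<Longrightarrow> prob_space (cdma_noise \<sigma> len)"
  unfolding cdma_noise_def by (intro prob_space_PiM prob_space_normal_density)

lemma block_avg_measurable:
  assumes "a < r" "r * w \<le> N" "m < n"
  shows "block_avg N w a m \<in> borel_measurable (PiM {..<n * N} (\<lambda>_. borel))"
  unfolding block_avg_def
  by (intro borel_measurable_divide borel_measurable_sum measurable_component_singleton)
     (use assms block_index_less in auto)

context
  fixes \<sigma> :: real and N w r a n :: nat
  assumes \<sigma>: "0 < \<sigma>" and w: "0 < w" and rw: "r * w \<le> N" and a: "a < r" and n: "0 < n"
begin

definition block :: "nat \<Rightarrow> nat set" where
  "block m = (\<lambda>q. m * N + (a * w + q)) ` {..<w}"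

lemma block_subset: "m < n \<Longrightarrow> block m \<subseteq> {..<n * N}"
  using block_index_less[OF a rw] by (auto simp: block_def)

lemma sum_block: "(\<Sum>i\<in>block m. y i) = (\<Sum>q<w. y (m * N + (a * w + q)))"
  unfolding block_def by (subst sum.reindex) (auto simp: inj_on_def)

lemma block_div: "i \<in> block m \<Longrightarrow> i div N = m"
  using block_index_less(2)[OF a rw] by (fastforce simp: block_def)

lemma indep_coordinates:
  "prob_space.indep_vars (cdma_noise \<sigma> (n * N)) (\<lambda>_. borel) (\<lambda>i x. x i) {..<n * N}"
  unfolding cdma_noise_def
proof (rule indep_vars_PiM_components)
  have "0 < N" using block_index_less(2)[OF a rw w] by simp
  then show "{..<n * N} \<noteq> {}" using n by (auto simp: lessThan_empty_iff)
qed (simp_all add: prob_space_normal_density \<sigma>)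

text \<open>Blocks for distinct m lie in different stretches of N positions, so the averages are
  functions of disjoint sets of independent coordinates.\<close>

lemma indep_block_avg:
  "prob_space.indep_vars (cdma_noise \<sigma> (n * N)) (\<lambda>_. borel) (block_avg N w a) {..<n}"
proof -
  interpret prob_space "cdma_noise \<sigma> (n * N)" by (rule prob_space_cdma_noise[OF \<sigma>])
  have "indep_vars (\<lambda>m. PiM (block m) (\<lambda>_. borel)) (\<lambda>m z. restrict (\<lambda>i. z i) (block m)) {..<n}"
    using block_subset
    by (intro indep_vars_restrict[OF indep_coordinates]) (auto simp: disjoint_family_on_def dest: block_div)
  then have "indep_vars (\<lambda>_. borel) (\<lambda>m z. (\<Sum>i\<in>block m. restrict (\<lambda>i. z i) (block m) i) / real w) {..<n}"
    by (rule indep_vars_compose2[where Y="\<lambda>m x. (\<Sum>i\<in>block m. x i) / real w"]) measurable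
  then show ?thesis
    by (simp add: sum_block block_avg_def[abs_def])
qed

lemma distributed_coordinate:
  assumes "i < n * N"
  shows "distributed (cdma_noise \<sigma> (n * N)) lborel (\<lambda>z. z i) (normal_density 0 \<sigma>)"
proof -
  have "distr (cdma_noise \<sigma> (n * N)) lborel (\<lambda>z. z i) = distr (cdma_noise \<sigma> (n * N)) (gauss \<sigma>) (\<lambda>z. z i)"
    by (rule distr_cong) simp_all
  also have "\<dots> = gauss \<sigma>"
    unfolding cdma_noise_def
    by (rule distr_PiM_component) (use assms prob_space_normal_density[OF \<sigma>] in auto)
  moreover have "(\<lambda>z. z i) \<in> borel_measurable (cdma_noise \<sigma> (n * N))"
    using sets_cdma_noise[of \<sigma> "n * N"] assms by (auto cong: measurable_cong_sets)
  ultimately show ?thesis by (simp add: distributed_def)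
qed

lemma distr_block_avg:
  assumes m: "m < n"
  shows "distr (cdma_noise \<sigma> (n * N)) borel (block_avg N w a m) = gauss (\<sigma> / sqrt (real w))"
proof -
  interpret prob_space "cdma_noise \<sigma> (n * N)" by (rule prob_space_cdma_noise[OF \<sigma>])
  have card: "card (block m) = w"
    unfolding block_def by (subst card_image) (auto simp: inj_on_def)
  have "distributed (cdma_noise \<sigma> (n * N)) lborel (\<lambda>z. \<Sum>i\<in>block m. z i)
      (normal_density (\<Sum>i\<in>block m. 0) (sqrt (\<Sum>i\<in>block m. \<sigma>\<^sup>2)))"
  proof (rule sum_indep_normal)
    show "finite (block m)" "block m \<noteq> {}" using w by (auto simp: block_def)
    show "indep_vars (\<lambda>_. borel) (\<lambda>i z. z i) (block m)"
      by (rule indep_vars_subset[OF indep_coordinates block_subset[OF m]])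
  qed (use \<sigma> block_subset[OF m] in \<open>auto intro: distributed_coordinate\<close>)
  then have *: "distributed (cdma_noise \<sigma> (n * N)) lborel (\<lambda>z. \<Sum>i\<in>block m. z i)
      (normal_density 0 (sqrt (real w) * \<sigma>))"
    using \<sigma> by (simp add: card real_sqrt_mult)
  have "0 < sqrt (real w) * \<sigma>" "1 / real w \<noteq> 0" using \<sigma> w by auto
  from normal_density_affine[OF * this, of 0]
  have "distributed (cdma_noise \<sigma> (n * N)) lborel (\<lambda>z. 1 / real w * (\<Sum>i\<in>block m. z i))
      (normal_density 0 (1 / real w * (sqrt (real w) * \<sigma>)))"
    by simp
  moreover have "1 / real w * (sqrt (real w) * \<sigma>) = \<sigma> / sqrt (real w)"
    using w by (simp add: field_simps)
  moreover have "(\<lambda>z. 1 / real w * (\<Sum>i\<in>block m. z i)) = block_avg N w a m"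
    by (simp add: sum_block block_avg_def fun_eq_iff)
  ultimately have "distr (cdma_noise \<sigma> (n * N)) lborel (block_avg N w a m) = gauss (\<sigma> / sqrt (real w))"
    by (simp add: distributed_def)
  moreover have "distr (cdma_noise \<sigma> (n * N)) lborel (block_avg N w a m)
      = distr (cdma_noise \<sigma> (n * N)) borel (block_avg N w a m)"
    by (rule distr_cong) simp_all
  ultimately show ?thesis by simp
qed

text \<open>This is the event that the true codeword misses the threshold. Its log-metric is a sum
  of n independent terms, bounded because \<psi> takes values in [\<epsilon>, 2], and with mean at
  least \<gamma>.\<close>

lemma prob_low_metric:
  assumes \<psi> [measurable]: "\<psi> \<in> borel_measurable borel"
    and \<epsilon>: "0 < \<epsilon>" "\<And>y. \<epsilon> \<le> \<psi> y" "\<And>y. \<psi> y \<le> 2"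
    and \<gamma>: "\<gamma> \<le> (\<integral>z. log 2 (\<psi> z) \<partial>gauss (\<sigma> / sqrt (real w)))"
  shows "measure (cdma_noise \<sigma> (n * N)) {z\<in>space (cdma_noise \<sigma> (n * N)).
      (\<Prod>m<n. \<psi> (block_avg N w a m z)) < 2 powr (real n * \<gamma>)}
    \<le> exp (- real n * (((\<integral>z. log 2 (\<psi> z) \<partial>gauss (\<sigma> / sqrt (real w))) - \<gamma>)\<^sup>2 / (2 * (\<bar>log 2 \<epsilon>\<bar> + 1)\<^sup>2)))"
    (is "?L \<le> ?R")
proof -
  interpret prob_space "cdma_noise \<sigma> (n * N)" by (rule prob_space_cdma_noise[OF \<sigma>])
  let ?X = "\<lambda>m z. log 2 (\<psi> (block_avg N w a m z))"
  have rv: "block_avg N w a m \<in> borel_measurable (cdma_noise \<sigma> (n * N))" if "m < n" for m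
    using indep_block_avg that by (auto simp: indep_vars_def)
  have pos: "0 < \<psi> y" for y using \<epsilon>(1) \<epsilon>(2)[of y] by linarith
  have ind: "indep_vars (\<lambda>_. borel) ?X {..<n}"
    by (rule indep_vars_compose2[OF indep_block_avg, where Y="\<lambda>_ x. log 2 (\<psi> x)"]) measurable
  have mu: "expectation (?X m) = (\<integral>z. log 2 (\<psi> z) \<partial>gauss (\<sigma> / sqrt (real w)))" if "m < n" for m
    unfolding distr_block_avg[OF that, symmetric]
    by (rule integral_distr[symmetric]) (use rv[OF that] in auto)
  have "?L \<le> prob {z\<in>space (cdma_noise \<sigma> (n * N)). (\<Sum>m<n. ?X m z) \<le> n * \<gamma>}"
  proof (rule finite_measure_mono)
    show "{z\<in>space (cdma_noise \<sigma> (n * N)). (\<Sum>m<n. ?X m z) \<le> n * \<gamma>} \<in> events"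
      using ind by (intro borel_measurable_le borel_measurable_sum) (auto simp: indep_vars_def)
    show "{z\<in>space (cdma_noise \<sigma> (n * N)). (\<Prod>m<n. \<psi> (block_avg N w a m z)) < 2 powr (real n * \<gamma>)}
      \<subseteq> {z\<in>space (cdma_noise \<sigma> (n * N)). (\<Sum>m<n. ?X m z) \<le> n * \<gamma>}"
    proof clarsimp
      fix z assume lt: "(\<Prod>m<n. \<psi> (block_avg N w a m z)) < 2 powr (real n * \<gamma>)"
      have ne: "\<psi> y \<noteq> 0" for y using pos[of y] by simp
      have "(\<Sum>m<n. ?X m z) = log 2 (\<Prod>m<n. \<psi> (block_avg N w a m z))"
        unfolding log_def by (subst ln_prod) (auto simp: sum_divide_distrib ne)
      also have "\<dots> \<le> log 2 (2 powr (real n * \<gamma>))"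
        using lt by (subst log_le_cancel_iff) (auto intro!: prod_pos pos)
      finally show "(\<Sum>m<n. ?X m z) \<le> real n * \<gamma>" by simp
    qed
  qed
  also have "\<dots> \<le> ?R"
  proof (rule bounded_sum_lower_tail[OF ind _ mu])
    show "\<bar>?X i x\<bar> \<le> \<bar>log 2 \<epsilon>\<bar> + 1" for i x
      by (rule abs_log2_le) (use \<epsilon> in auto)
  qed (use \<gamma> n in auto)
  finally show ?thesis .
qed

end

text \<open>For fixed noise and a fixed nonzero d, the metric under a uniform matrix is a product of
  independent factors of mean 1, so it reaches \<theta> for at most a fraction 1 / \<theta> of the
  matrices. At most 2^l vectors d compete.\<close>

lemma card_confusing_matrices_le:
  fixes \<psi> :: "real \<Rightarrow> real"
  assumes nn: "\<And>y. 0 \<le> \<psi> y" and sum2: "\<And>y. \<psi> y + \<psi> (y + 1) = 2" and \<theta>: "0 < \<theta>"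
  shows "real (card {G\<in>matrices n l. \<exists>d\<in>Pow {..<l} - {{}}.
      \<theta> \<le> (\<Prod>m<n. \<psi> (x m + bit_val (odd (card (G m \<inter> d)))))}) \<le> real (card (matrices n l)) * (2 ^ l / \<theta>)"
proof -
  have "real (card {G\<in>matrices n l. \<exists>d\<in>Pow {..<l} - {{}}.
      \<theta> \<le> (\<Prod>m<n. \<psi> (x m + bit_val (odd (card (G m \<inter> d)))))})
      \<le> card (Pow {..<l} - {{}}) * (real (card (matrices n l)) / \<theta>)"
  proof (rule card_ex_le)
    fix d assume "d \<in> Pow {..<l} - {{}}"
    then have d: "d \<subseteq> {..<l}" "d \<noteq> {}" by auto
    have "(\<psi> (y + bit_val True) + \<psi> (y + bit_val False)) / 2 = 1" for y
      using sum2[of y] by (simp add: bit_val_def)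
    then have avg: "(\<Prod>m<n. (\<psi> (x m + bit_val True) + \<psi> (x m + bit_val False)) / 2) = 1"
      by simp
    show "real (card {G\<in>matrices n l. \<theta> \<le> (\<Prod>m<n. \<psi> (x m + bit_val (odd (card (G m \<inter> d)))))})
        \<le> real (card (matrices n l)) / \<theta>"
      using card_matrices_markov[OF d nn, of n \<theta> "\<lambda>m b. x m + bit_val b"] \<theta>
      unfolding avg by (simp add: pos_le_divide_eq)
  qed auto
  also have "\<dots> \<le> 2 ^ l * (real (card (matrices n l)) / \<theta>)"
  proof (rule mult_right_mono)
    have "card (Pow {..<l} - {{}}) \<le> card (Pow {..<l})" by (intro card_mono) auto
    then show "real (card (Pow {..<l} - {{}})) \<le> 2 ^ l"
      by (simp add: card_Pow flip: of_nat_le_iff[where 'a=real])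
  qed (use \<theta> in simp)
  finally show ?thesis by (simp add: mult.commute)
qed

section \<open>The code\<close>

text \<open>The decoder makes choices by \<open>SOME\<close>. It is measurable because it depends on
  the reception only through a finite set of candidates, and on a discrete space every further
  function is measurable.\<close>

lemma measurable_finite_Collect:
  assumes "finite A" and "\<And>x. x \<in> A \<Longrightarrow> {y\<in>space M. P y x} \<in> sets M"
  shows "(\<lambda>y. {x\<in>A. P y x}) \<in> measurable M (count_space UNIV)"
proof -
  have "(\<lambda>y. {x\<in>A. P y x}) \<in> measurable M (count_space (Pow A))"
  proof (subst measurable_count_space_eq2, safe)
    fix S assume "S \<subseteq> A"
    have "(\<lambda>y. {x\<in>A. P y x}) -` {S} \<inter> space M
        = {y\<in>space M. \<forall>x\<in>A. P y x \<longleftrightarrow> x \<in> S}"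
      using \<open>S \<subseteq> A\<close> by auto
    also have "\<dots> \<in> sets M"
    proof (rule sets.sets_Collect_finite_All[OF _ assms(1)])
      fix x assume "x \<in> A"
      from assms(2)[OF this] show "{y\<in>space M. P y x \<longleftrightarrow> x \<in> S} \<in> sets M"
        by (cases "x \<in> S") (auto intro: sets.sets_Collect_neg)
    qed
    finally show "(\<lambda>y. {x\<in>A. P y x}) -` {S} \<inter> space M \<in> sets M" .
  qed (use assms in auto)
  then show ?thesis
    by (rule measurable_compose[where g="\<lambda>x. x"]) simp
qed

text \<open>Mapping by v turns the default \<open>undefined\<close> outside the block into
  \<open>v undefined\<close>, hence the restriction to events that depend on the first k coordinates
  only.\<close>

lemma iid_map_prob:
  assumes "\<And>\<omega> \<omega>'. (\<And>t. t < k \<Longrightarrow> \<omega> t = \<omega>' t) \<Longrightarrow> E \<omega> \<longleftrightarrow> E \<omega>'"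
  shows "measure_pmf.prob (iid k (map_pmf v P)) {\<omega>. E \<omega>}
    = measure_pmf.prob (iid k P) {\<omega>. E (\<lambda>t. v (\<omega> t))}"
proof -
  have "iid k (map_pmf v P)
      = map_pmf (\<lambda>f t. if t \<in> {..<k} then f t else undefined) (Pi_pmf {..<k} (v undefined) (\<lambda>_. map_pmf v P))"
    unfolding iid_def by (rule Pi_pmf_default_swap[symmetric]) simp
  also have "Pi_pmf {..<k} (v undefined) (\<lambda>_. map_pmf v P) = map_pmf (\<lambda>f. v \<circ> f) (iid k P)"
    unfolding iid_def by (rule Pi_pmf_map) auto
  finally have "measure_pmf.prob (iid k (map_pmf v P)) {\<omega>. E \<omega>}
      = measure_pmf.prob (iid k P) {\<omega>. E (\<lambda>t. if t < k then v (\<omega> t) else undefined)}"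
    by (simp add: pmf.map_comp o_def vimage_def)
  also have "{\<omega>. E (\<lambda>t. if t < k then v (\<omega> t) else undefined)} = {\<omega>. E (\<lambda>t. v (\<omega> t))}"
  proof -
    have "E (\<lambda>t. if t < k then v (\<omega> t) else undefined) \<longleftrightarrow> E (\<lambda>t. v (\<omega> t))" for \<omega>
      by (rule assms) simp
    then show ?thesis by simp
  qed
  finally show ?thesis .
qed

text \<open>B is the l x k compression matrix, G the n x l generator matrix of the channel code, w
  the number of signature positions given to each row of h, and \<theta> the decoding
  threshold.\<close>

locale code_params =
  fixes h :: "nat \<Rightarrow> 'l::finite \<Rightarrow> bool" and r w N n k l :: nat
    and B :: "nat \<Rightarrow> nat \<Rightarrow> bool" and swdec :: "(nat \<Rightarrow> nat \<Rightarrow> bool) \<Rightarrow> nat \<Rightarrow> bool list"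
    and G :: "nat \<Rightarrow> nat set" and \<psi> :: "real \<Rightarrow> real" and \<theta> :: real
  assumes w: "0 < w" and rw: "r * w \<le> N"
    and psi_measurable [measurable]: "\<psi> \<in> borel_measurable borel"
    and psi_add: "\<And>y. \<psi> y + \<psi> (y + 1) = 2"
begin

definition encoder :: "'l \<Rightarrow> (nat \<Rightarrow> bool) \<Rightarrow> nat \<Rightarrow> bool" where
  "encoder j x m = odd (card {a \<in> {..<l}. a \<in> G m \<and> odd (card {t \<in> {..<k}. B a t \<and> x t})})"

text \<open>Positions from r w on, if N leaves any, carry 0.\<close>

definition signature :: "'l \<Rightarrow> nat \<Rightarrow> bool" where
  "signature j q \<longleftrightarrow> q < r * w \<and> h (q div w) j"

text \<open>In this locale \<psi> has period 2, so adding the hypothetical bit amounts to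
  subtracting it and the reception need not be reduced modulo 2 explicitly.\<close>

definition metric :: "nat \<Rightarrow> nat set \<Rightarrow> (nat \<Rightarrow> real) \<Rightarrow> real" where
  "metric a u y = (\<Prod>m<n. \<psi> (block_avg N w a m y + bit_val (odd (card (G m \<inter> u)))))"

definition candidates :: "(nat \<Rightarrow> real) \<Rightarrow> (nat \<times> nat set) set" where
  "candidates y = {x \<in> {..<r} \<times> Pow {..<l}. \<theta> \<le> metric (fst x) (snd x) y}"

definition message :: "(nat \<times> nat set) set \<Rightarrow> nat \<Rightarrow> nat \<Rightarrow> bool" where
  "message C = (\<lambda>a b. if a < r \<and> b < l then b \<in> (SOME u. (a, u) \<in> C) else False)"

text \<open>Any x with the decoded syndromes will do, by the compatibility of f assumed in
  \<open>decoder_correct\<close>.\<close>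

definition decoder :: "(nat \<Rightarrow> ('l \<Rightarrow> bool) \<Rightarrow> 'b) \<Rightarrow> (nat \<Rightarrow> real) \<Rightarrow> nat \<Rightarrow> nat \<Rightarrow> 'b" where
  "decoder f y i t = f i (SOME x. \<forall>a<r. dotF2 (h a) x = swdec (message (candidates y)) t ! a)"

definition syndromes :: "('l \<Rightarrow> bool) \<Rightarrow> bool list" where
  "syndromes x = map (\<lambda>a. dotF2 (h a) x) [0..<r]"

definition true_message :: "(nat \<Rightarrow> 'l \<Rightarrow> bool) \<Rightarrow> nat \<Rightarrow> nat set" where
  "true_message \<omega> a = {b \<in> {..<l}. odd (card {t \<in> {..<k}. B b t \<and> dotF2 (h a) (\<omega> t)})}"

lemma metric_measurable:
  assumes "a < r"
  shows "metric a u \<in> borel_measurable (PiM {..<n * N} (\<lambda>_. borel))"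
proof -
  have [measurable]: "block_avg N w a m \<in> borel_measurable (PiM {..<n * N} (\<lambda>_. borel))"
    if "m < n" for m
    using assms rw that by (rule block_avg_measurable)
  show ?thesis
    unfolding metric_def[abs_def] by (rule borel_measurable_prod) measurable
qed

lemma decoder_measurable: "cdma_decoder_measurable b N k n (decoder f)"
  unfolding cdma_decoder_measurable_def
proof safe
  fix i t
  have "candidates \<in> measurable (PiM {..<n * N} (\<lambda>_. borel)) (count_space UNIV)"
    unfolding candidates_def[abs_def]
  proof (rule measurable_finite_Collect)
    fix x assume "x \<in> {..<r} \<times> Pow {..<l}"
    then have "fst x < r" by auto
    then have [measurable]: "metric (fst x) (snd x) \<in> borel_measurable (PiM {..<n * N} (\<lambda>_. borel))"
      by (rule metric_measurable)
    show "{y \<in> space (PiM {..<n * N} (\<lambda>_. borel)). \<theta> \<le> metric (fst x) (snd x) y}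
        \<in> sets (PiM {..<n * N} (\<lambda>_. borel))"
      by measurable
  qed simp
  then show "(\<lambda>y. decoder f y i t) \<in> measurable (PiM {..<n * N} (\<lambda>_. borel)) (count_space UNIV)"
    unfolding decoder_def
    by (rule measurable_compose[where g="\<lambda>C. f i (SOME x. \<forall>a<r. dotF2 (h a) x = swdec (message C) t ! a)"]) simp
qed

text \<open>The identity for y and y + 1 gives \<psi> period 2, so a real sum of bits acts on it
  through its parity only. Here real superposition turns into addition over F2.\<close>

lemma psi_add_nat: "\<psi> (real c + y) = \<psi> (y + bit_val (odd c))"
proof (induction c)
  case (Suc c)
  have "\<psi> (real (Suc c) + y) = 2 - \<psi> (real c + y)"
    using psi_add[of "real c + y"] by (simp add: add_ac)
  also have "\<dots> = 2 - \<psi> (y + bit_val (odd c))" by (simp only: Suc.IH)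
  also have "\<dots> = \<psi> (y + bit_val (odd (Suc c)))"
    using psi_add[of y] by (cases "odd c") (simp_all add: bit_val_def)
  finally show ?case .
qed (simp add: bit_val_def)

lemma psi_add_bits: "\<psi> (y + bit_val x + bit_val x') = \<psi> (y + bit_val (x \<noteq> x'))"
  using psi_add[of y] psi_add[of "y + 1"] by (cases x; cases x') (simp_all add: bit_val_def)

text \<open>The row of h is moved inward twice, past the generator matrix (sum over b) and past the
  compression matrix (sum over t), until it meets the observations and forms V_a.\<close>

lemma parity_received:
  "odd (card {j. encoder j (\<lambda>t. if t < k then \<omega> t j else False) m \<and> h a j})
    \<longleftrightarrow> odd (card (G m \<inter> true_message \<omega> a))"
proof -
  have e: "encoder j (\<lambda>t. if t < k then \<omega> t j else False) m
      \<longleftrightarrow> odd (card {b \<in> {..<l}. b \<in> G m \<and> odd (card {t \<in> {..<k}. B b t \<and> \<omega> t j})})" for j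
  proof -
    have "{t \<in> {..<k}. B b t \<and> (if t < k then \<omega> t j else False)} = {t \<in> {..<k}. B b t \<and> \<omega> t j}" for b
      by auto
    then show ?thesis by (simp add: encoder_def)
  qed
  have "odd (card {j. encoder j (\<lambda>t. if t < k then \<omega> t j else False) m \<and> h a j})
     \<longleftrightarrow> odd (card {j \<in> UNIV. h a j \<and> odd (card {b \<in> {..<l}. b \<in> G m \<and> odd (card {t \<in> {..<k}. B b t \<and> \<omega> t j})})})"
    by (simp add: e conj_commute)
  also have "\<dots> \<longleftrightarrow> odd (card {b \<in> {..<l}. b \<in> G m \<and> odd (card {j \<in> UNIV. h a j \<and> odd (card {t \<in> {..<k}. B b t \<and> \<omega> t j})})})"
    by (rule odd_card_product_swap) auto
  also have "\<dots> \<longleftrightarrow> odd (card {b \<in> {..<l}. b \<in> G m \<and> odd (card {t \<in> {..<k}. B b t \<and> odd (card {j \<in> UNIV. h a j \<and> \<omega> t j})})})"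
    by (subst odd_card_product_swap[of UNIV "{..<k}"]) auto
  also have "{b \<in> {..<l}. b \<in> G m \<and> odd (card {t \<in> {..<k}. B b t \<and> odd (card {j \<in> UNIV. h a j \<and> \<omega> t j})})}
      = G m \<inter> true_message \<omega> a"
    by (auto simp: true_message_def dotF2_def)
  finally show ?thesis .
qed

lemma block_avg_received:
  assumes "a < r" "m < n"
  shows "block_avg N w a m (cdma_received N k n encoder signature \<omega> z)
    = real (card {j. encoder j (\<lambda>t. if t < k then \<omega> t j else False) m \<and> h a j}) + block_avg N w a m z"
proof -
  let ?c = "card {j. encoder j (\<lambda>t. if t < k then \<omega> t j else False) m \<and> h a j}"
  have "cdma_received N k n encoder signature \<omega> z (m * N + (a * w + q))
      = real ?c + z (m * N + (a * w + q))" if q: "q < w" for q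
  proof -
    note idx = block_index_less[OF assms(1) rw q]
    have dm: "(m * N + (a * w + q)) div N = m" "(m * N + (a * w + q)) mod N = a * w + q"
      using idx(2) by auto
    have dw: "(a * w + q) div w = a" using q by auto
    show ?thesis
      using idx(1) idx(3)[OF assms(2)]
      by (simp add: cdma_received_def dm mod_less[OF idx(2)] signature_def dw sum.If_cases)
  qed
  then have "(\<Sum>q<w. cdma_received N k n encoder signature \<omega> z (m * N + (a * w + q)))
     = real w * real ?c + (\<Sum>q<w. z (m * N + (a * w + q)))"
    by (simp add: sum.distrib)
  then show ?thesis using w by (simp add: block_avg_def add_divide_distrib)
qed

text \<open>A hypothesis evaluated on the reception equals its difference from the truth evaluated
  on the noise. This removes the source from the analysis of channel errors.\<close>

lemma metric_received:
  assumes "a < r" "u \<subseteq> {..<l}"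
  shows "metric a u (cdma_received N k n encoder signature \<omega> z) = metric a (sym_diff (true_message \<omega> a) u) z"
  unfolding metric_def
proof (intro prod.cong refl)
  fix m assume m: "m \<in> {..<n}"
  have fin: "finite (true_message \<omega> a)" "finite u"
    using assms(2) by (auto simp: true_message_def finite_subset)
  show "\<psi> (block_avg N w a m (cdma_received N k n encoder signature \<omega> z) + bit_val (odd (card (G m \<inter> u))))
      = \<psi> (block_avg N w a m z + bit_val (odd (card (G m \<inter> sym_diff (true_message \<omega> a) u))))"
  proof -
    let ?c = "card {j. encoder j (\<lambda>t. if t < k then \<omega> t j else False) m \<and> h a j}"
    let ?\<beta> = "odd (card (G m \<inter> u))"
    have "\<psi> (block_avg N w a m (cdma_received N k n encoder signature \<omega> z) + bit_val ?\<beta>)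
        = \<psi> (real ?c + (block_avg N w a m z + bit_val ?\<beta>))"
      using m by (simp only: block_avg_received[OF assms(1)] lessThan_iff add.assoc)
    also have "\<dots> = \<psi> (block_avg N w a m z + bit_val ?\<beta> + bit_val (odd ?c))"
      by (rule psi_add_nat)
    also have "\<dots> = \<psi> (block_avg N w a m z + bit_val (?\<beta> \<noteq> odd ?c))"
      by (rule psi_add_bits)
    also have "(?\<beta> \<noteq> odd ?c) = odd (card (G m \<inter> sym_diff (true_message \<omega> a) u))"
      unfolding parity_received odd_card_sym_diff[OF fin] by blast
    finally show ?thesis .
  qed
qed

text \<open>\<open>low\<close> admits the true message of each row and \<open>conf\<close> excludes
  every other, so the choices of the decoder are determined.\<close>

lemma decoder_correct:
  assumes f: "\<And>i x x'. i < b \<Longrightarrow> (\<forall>a<r. dotF2 (h a) x = dotF2 (h a) x') \<Longrightarrow> f i x = f i x'"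
    and low: "\<And>a. a < r \<Longrightarrow> \<theta> \<le> metric a {} z"
    and conf: "\<And>a d. a < r \<Longrightarrow> d \<subseteq> {..<l} \<Longrightarrow> d \<noteq> {} \<Longrightarrow> metric a d z < \<theta>"
    and sw: "\<And>t. t < k \<Longrightarrow> swdec (sw_compress r l k B (\<lambda>t. syndromes (\<omega> t))) t = syndromes (\<omega> t)"
    and "i < b" "t < k"
  shows "decoder f (cdma_received N k n encoder signature \<omega> z) i t = f i (\<omega> t)"
proof -
  let ?y = "cdma_received N k n encoder signature \<omega> z"
  have U: "true_message \<omega> a \<subseteq> {..<l}" for a by (auto simp: true_message_def)
  have "(SOME u. (a, u) \<in> candidates ?y) = true_message \<omega> a" if a: "a < r" for a
  proof (rule some_equality)
    show "(a, true_message \<omega> a) \<in> candidates ?y"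
      using a low[OF a] U by (simp add: candidates_def metric_received)
  next
    fix u assume "(a, u) \<in> candidates ?y"
    then have u: "u \<subseteq> {..<l}" "\<theta> \<le> metric a (sym_diff (true_message \<omega> a) u) z"
      using a by (auto simp: candidates_def metric_received)
    have "sym_diff (true_message \<omega> a) u \<subseteq> {..<l}" using u(1) U[of a] by auto
    with conf[OF a this] u(2) have "sym_diff (true_message \<omega> a) u = {}" by fastforce
    then show "u = true_message \<omega> a" by auto
  qed
  then have "message (candidates ?y) = sw_compress r l k B (\<lambda>t. syndromes (\<omega> t))"
    by (auto simp: message_def sw_compress_def true_message_def syndromes_def fun_eq_iff)
  then have "decoder f ?y i t = f i (SOME x. \<forall>a<r. dotF2 (h a) x = syndromes (\<omega> t) ! a)"
    using sw[OF \<open>t < k\<close>] by (simp add: decoder_def)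
  also have "\<dots> = f i (\<omega> t)"
  proof (rule f[OF \<open>i < b\<close>])
    have "\<forall>a<r. dotF2 (h a) (\<omega> t) = syndromes (\<omega> t) ! a" by (simp add: syndromes_def)
    from someI[of "\<lambda>x. \<forall>a<r. dotF2 (h a) x = syndromes (\<omega> t) ! a", OF this]
    show "\<forall>a<r. dotF2 (h a) (SOME x. \<forall>a<r. dotF2 (h a) x = syndromes (\<omega> t) ! a) = dotF2 (h a) (\<omega> t)"
      by (simp add: syndromes_def)
  qed
  finally show ?thesis .
qed

end

section \<open>Error probability of the code\<close>

context code_params
begin

text \<open>The empty set is the difference of the true message from itself.\<close>

definition weak_noise :: "real \<Rightarrow> nat \<Rightarrow> (nat \<Rightarrow> real) set" where
  "weak_noise \<sigma> a = {z \<in> space (cdma_noise \<sigma> (n * N)). metric a {} z < \<theta>}"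

definition confusing_noise :: "real \<Rightarrow> nat \<Rightarrow> (nat \<Rightarrow> real) set" where
  "confusing_noise \<sigma> a = {z \<in> space (cdma_noise \<sigma> (n * N)). \<exists>d\<in>Pow {..<l} - {{}}. \<theta> \<le> metric a d z}"

lemma noise_events:
  assumes "a < r"
  shows "weak_noise \<sigma> a \<in> sets (cdma_noise \<sigma> (n * N))" "confusing_noise \<sigma> a \<in> sets (cdma_noise \<sigma> (n * N))"
proof -
  have [measurable]: "metric a u \<in> borel_measurable (cdma_noise \<sigma> (n * N))" for u
    using metric_measurable[OF assms] by (simp cong: measurable_cong_sets add: sets_cdma_noise)
  show "weak_noise \<sigma> a \<in> sets (cdma_noise \<sigma> (n * N))" unfolding weak_noise_def by measurable
  show "confusing_noise \<sigma> a \<in> sets (cdma_noise \<sigma> (n * N))"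
    unfolding confusing_noise_def by (rule sets.sets_Collect_finite_Ex) auto
qed

lemma error_prob_le:
  assumes f: "\<And>i x x'. i < b \<Longrightarrow> (\<forall>a<r. dotF2 (h a) x = dotF2 (h a) x') \<Longrightarrow> f i x = f i x'"
    and \<sigma>: "0 < \<sigma>"
  shows "cdma_error_prob P f b \<sigma> N k n encoder signature (decoder f)
    \<le> measure_pmf.prob (iid k (map_pmf syndromes P)) {\<omega>. \<exists>t<k. swdec (sw_compress r l k B \<omega>) t \<noteq> \<omega> t}
      + (\<Sum>a<r. measure (cdma_noise \<sigma> (n * N)) (weak_noise \<sigma> a)
          + measure (cdma_noise \<sigma> (n * N)) (confusing_noise \<sigma> a))"
proof -
  interpret prob_space "cdma_noise \<sigma> (n * N)" by (rule prob_space_cdma_noise[OF \<sigma>])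
  define S where "S = {\<omega>. \<exists>t<k. swdec (sw_compress r l k B (\<lambda>t. syndromes (\<omega> t))) t \<noteq> syndromes (\<omega> t)}"
  define e where "e = (\<Sum>a<r. prob (weak_noise \<sigma> a) + prob (confusing_noise \<sigma> a))"
  define bad where "bad = (\<lambda>\<omega>. {z \<in> space (cdma_noise \<sigma> (n * N)).
    \<exists>i<b. \<exists>t<k. decoder f (cdma_received N k n encoder signature \<omega> z) i t \<noteq> f i (\<omega> t)})"
  \<comment> \<open>A source outcome in S is charged the full probability 1; for any other, a
    decoding error forces weak or confusing noise in some row.\<close>
  have le: "prob (bad \<omega>) \<le> indicator S \<omega> + e" for \<omega>
  proof (cases "\<omega> \<in> S")
    case True
    have "0 \<le> e" unfolding e_def by (intro sum_nonneg) auto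
    moreover have "prob (bad \<omega>) \<le> 1" by (rule prob_le_1)
    moreover have "indicator S \<omega> = (1 :: real)" using True by simp
    ultimately show ?thesis by linarith
  next
    case False
    have "bad \<omega> \<subseteq> (\<Union>a<r. weak_noise \<sigma> a \<union> confusing_noise \<sigma> a)"
    proof
      fix z assume z: "z \<in> bad \<omega>"
      show "z \<in> (\<Union>a<r. weak_noise \<sigma> a \<union> confusing_noise \<sigma> a)"
      proof (rule ccontr)
        assume n: "z \<notin> (\<Union>a<r. weak_noise \<sigma> a \<union> confusing_noise \<sigma> a)"
        have zs: "z \<in> space (cdma_noise \<sigma> (n * N))" using z by (simp add: bad_def)
        have "decoder f (cdma_received N k n encoder signature \<omega> z) i t = f i (\<omega> t)" if "i < b" "t < k" for i t
        proof (rule decoder_correct[OF f])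
          show "\<theta> \<le> metric a {} z" if "a < r" for a
            using n zs that by (force simp: weak_noise_def not_less)
          show "metric a d z < \<theta>" if "a < r" "d \<subseteq> {..<l}" "d \<noteq> {}" for a d
            using n zs that by (force simp: confusing_noise_def not_le)
        qed (use False that in \<open>auto simp: S_def\<close>)
        with z show False by (auto simp: bad_def)
      qed
    qed
    then have "prob (bad \<omega>) \<le> prob (\<Union>a<r. weak_noise \<sigma> a \<union> confusing_noise \<sigma> a)"
      using noise_events by (intro finite_measure_mono) auto
    also have "\<dots> \<le> (\<Sum>a<r. prob (weak_noise \<sigma> a \<union> confusing_noise \<sigma> a))"
      using noise_events by (intro finite_measure_subadditive_finite) auto
    also have "\<dots> \<le> e"
      unfolding e_def using noise_events by (intro sum_mono measure_Un_le) auto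
    finally show ?thesis using False by simp
  qed
  have "cdma_error_prob P f b \<sigma> N k n encoder signature (decoder f)
      = measure_pmf.expectation (iid k P) (\<lambda>\<omega>. prob (bad \<omega>))"
    by (simp add: cdma_error_prob_def bad_def)
  also have "\<dots> \<le> measure_pmf.expectation (iid k P) (\<lambda>\<omega>. indicator S \<omega> + e)"
  proof (rule integral_mono)
    show "integrable (measure_pmf (iid k P)) (\<lambda>\<omega>. prob (bad \<omega>))"
      by (rule measure_pmf.integrable_const_bound[where B=1]) (auto intro: prob_le_1)
    show "integrable (measure_pmf (iid k P)) (\<lambda>\<omega>. indicator S \<omega> + e)"
      by (intro Bochner_Integration.integrable_add)
         (auto simp: measure_pmf.emeasure_eq_measure)
  qed (rule le)
  also have "\<dots> = measure_pmf.prob (iid k P) S + e"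
    by (subst Bochner_Integration.integral_add)
       (auto simp: measure_pmf.prob_space measure_pmf.emeasure_eq_measure)
  also have "measure_pmf.prob (iid k P) S
      = measure_pmf.prob (iid k (map_pmf syndromes P)) {\<omega>. \<exists>t<k. swdec (sw_compress r l k B \<omega>) t \<noteq> \<omega> t}"
    unfolding S_def
  proof (rule iid_map_prob[symmetric])
    fix \<omega> \<omega>' :: "nat \<Rightarrow> bool list" assume eq: "\<And>t. t < k \<Longrightarrow> \<omega> t = \<omega>' t"
    have "{t. t < k \<and> B a t \<and> \<omega> t ! i} = {t. t < k \<and> B a t \<and> \<omega>' t ! i}" for a i
      using eq by auto
    then have "sw_compress r l k B \<omega> = sw_compress r l k B \<omega>'"
      by (simp add: sw_compress_def)
    then show "(\<exists>t<k. swdec (sw_compress r l k B \<omega>) t \<noteq> \<omega> t) \<longleftrightarrow> (\<exists>t<k. swdec (sw_compress r l k B \<omega>') t \<noteq> \<omega>' t)"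
      using eq by auto
  qed
  finally show ?thesis by (simp add: e_def)
qed

end

lemma linear_code_exists:
  fixes P :: "('l::finite \<Rightarrow> bool) pmf" and h :: "nat \<Rightarrow> 'l \<Rightarrow> bool"
    and f :: "nat \<Rightarrow> ('l \<Rightarrow> bool) \<Rightarrow> 'b"
  assumes f: "\<And>i x x'. i < b \<Longrightarrow> (\<forall>a<r. dotF2 (h a) x = dotF2 (h a) x') \<Longrightarrow> f i x = f i x'"
    and \<sigma>: "0 < \<sigma>" and w: "0 < w" and rw: "r * w \<le> N" and n: "0 < n"
    and \<psi>: "\<psi> \<in> borel_measurable borel" "\<And>y. \<psi> y + \<psi> (y + 1) = 2"
    and \<epsilon>: "0 < \<epsilon>" "\<And>y. \<epsilon> \<le> \<psi> y" "\<And>y. \<psi> y \<le> 2"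
    and \<mu>: "\<mu> = (\<integral>z. log 2 (\<psi> z) \<partial>gauss (\<sigma> / sqrt (real w)))" and \<gamma>: "\<gamma> \<le> \<mu>"
  shows "\<exists>enc s dec. cdma_decoder_measurable b N k n dec \<and>
    cdma_error_prob P f b \<sigma> N k n enc s dec
      \<le> measure_pmf.prob (iid k (map_pmf (\<lambda>x. map (\<lambda>a. dotF2 (h a) x) [0..<r]) P))
           {\<omega>. \<exists>t<k. swdec (sw_compress r l k B \<omega>) t \<noteq> \<omega> t}
        + real r * (exp (- real n * ((\<mu> - \<gamma>)\<^sup>2 / (2 * (\<bar>log 2 \<epsilon>\<bar> + 1)\<^sup>2))) + 2 ^ l / 2 powr (real n * \<gamma>))"
proof -
  interpret prob_space "cdma_noise \<sigma> (n * N)" by (rule prob_space_cdma_noise[OF \<sigma>])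
  define \<theta> where "\<theta> = 2 powr (real n * \<gamma>)"
  have \<theta>: "0 < \<theta>" by (simp add: \<theta>_def)
  have \<psi>_nonneg: "0 \<le> \<psi> y" for y using \<epsilon>(1) \<epsilon>(2)[of y] by linarith
  define conf where "conf = (\<lambda>a (G :: nat \<Rightarrow> nat set) z. \<exists>d\<in>Pow {..<l} - {{}}.
     \<theta> \<le> (\<Prod>m<n. \<psi> (block_avg N w a m z + bit_val (odd (card (G m \<inter> d))))))"
  \<comment> \<open>The locale predicate involves only r, w, N and \<psi>, so the notions of the
    locale are available for every G before one is selected.\<close>
  have cp: "code_params r w N \<psi>" by unfold_locales (use w rw \<psi> in auto)
  have conf_eq: "{z \<in> space (cdma_noise \<sigma> (n * N)). conf a G z}
      = code_params.confusing_noise w N n l G \<psi> \<theta> \<sigma> a" for a G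
    by (simp add: conf_def code_params.confusing_noise_def[OF cp] code_params.metric_def[OF cp])
  have "(\<Sum>G\<in>matrices n l. \<Sum>a<r. prob {z \<in> space (cdma_noise \<sigma> (n * N)). conf a G z})
      = (\<Sum>a<r. \<Sum>G\<in>matrices n l. prob {z \<in> space (cdma_noise \<sigma> (n * N)). conf a G z})"
    by (rule sum.swap)
  also have "\<dots> \<le> (\<Sum>a<r. real (card (matrices n l)) * (2 ^ l / \<theta>))"
  proof (intro sum_mono sum_prob_le_count finite_matrices)
    fix a G assume "a \<in> {..<r}"
    then show "{z \<in> space (cdma_noise \<sigma> (n * N)). conf a G z} \<in> events"
      unfolding conf_eq using code_params.noise_events(2)[OF cp] by simp
  next
    fix a z
    show "real (card {G\<in>matrices n l. conf a G z}) \<le> real (card (matrices n l)) * (2 ^ l / \<theta>)"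
      unfolding conf_def by (rule card_confusing_matrices_le[where \<psi>=\<psi>, OF \<psi>_nonneg \<psi>(2) \<theta>])
  qed
  finally have "(\<Sum>G\<in>matrices n l. \<Sum>a<r. prob {z \<in> space (cdma_noise \<sigma> (n * N)). conf a G z})
      \<le> real (card (matrices n l)) * (real r * (2 ^ l / \<theta>))"
    by (simp add: mult_ac)
  from exists_le_average[OF finite_matrices card_matrices_pos this]
  obtain G where G: "(\<Sum>a<r. prob {z \<in> space (cdma_noise \<sigma> (n * N)). conf a G z}) \<le> real r * (2 ^ l / \<theta>)"
    by blast
  interpret C: code_params h r w N n k l B swdec G \<psi> \<theta> by (rule cp)
  \<comment> \<open>The metric of the empty set meets even parities only and does not depend on G,
    so this bound holds for the matrix selected above.\<close>
  have weak: "prob (C.weak_noise \<sigma> a) \<le> exp (- real n * ((\<mu> - \<gamma>)\<^sup>2 / (2 * (\<bar>log 2 \<epsilon>\<bar> + 1)\<^sup>2)))"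
    if "a < r" for a
  proof -
    have "C.weak_noise \<sigma> a = {z\<in>space (cdma_noise \<sigma> (n * N)).
      (\<Prod>m<n. \<psi> (block_avg N w a m z)) < 2 powr (real n * \<gamma>)}"
      unfolding C.weak_noise_def C.metric_def by (simp add: bit_val_def \<theta>_def)
    then show ?thesis
      using prob_low_metric[OF \<sigma> w rw that n \<psi>(1) \<epsilon>, of \<gamma>] \<gamma> \<mu> by simp
  qed
  have "cdma_error_prob P f b \<sigma> N k n C.encoder C.signature (C.decoder f)
    \<le> measure_pmf.prob (iid k (map_pmf C.syndromes P)) {\<omega>. \<exists>t<k. swdec (sw_compress r l k B \<omega>) t \<noteq> \<omega> t}
      + (\<Sum>a<r. prob (C.weak_noise \<sigma> a) + prob (C.confusing_noise \<sigma> a))"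
    by (rule C.error_prob_le[OF f \<sigma>])
  also have "(\<Sum>a<r. prob (C.weak_noise \<sigma> a) + prob (C.confusing_noise \<sigma> a))
      \<le> (\<Sum>a<r. exp (- real n * ((\<mu> - \<gamma>)\<^sup>2 / (2 * (\<bar>log 2 \<epsilon>\<bar> + 1)\<^sup>2)))) + real r * (2 ^ l / \<theta>)"
    unfolding sum.distrib using G weak by (intro add_mono sum_mono) (auto simp: conf_eq)
  also have "\<dots> = real r * (exp (- real n * ((\<mu> - \<gamma>)\<^sup>2 / (2 * (\<bar>log 2 \<epsilon>\<bar> + 1)\<^sup>2))) + 2 ^ l / 2 powr (real n * \<gamma>))"
    by (simp add: \<theta>_def distrib_left)
  also have "C.syndromes = (\<lambda>x. map (\<lambda>a. dotF2 (h a) x) [0..<r])"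
    by (simp add: C.syndromes_def fun_eq_iff)
  finally show ?thesis
    using C.decoder_measurable by (intro exI conjI) auto
qed

section \<open>Achievable rates\<close>

text \<open>Each row carries about k R' compressed bits with k about R N n. The channel code
  therefore has rate about R N R', which is below the capacity.\<close>

lemma cdma_achievable_rate:
  fixes P :: "('l::finite \<Rightarrow> bool) pmf" and h :: "nat \<Rightarrow> 'l \<Rightarrow> bool"
    and f :: "nat \<Rightarrow> ('l \<Rightarrow> bool) \<Rightarrow> 'b"
  assumes f: "\<And>i x x'. i < b \<Longrightarrow> (\<forall>a<r. dotF2 (h a) x = dotF2 (h a) x') \<Longrightarrow> f i x = f i x'"
    and \<sigma>: "0 < \<sigma>" and w: "0 < w" and rw: "r * w \<le> N" and N: "0 < N"
    and sw: "sw_achievable (map_pmf (\<lambda>x. map (\<lambda>a. dotF2 (h a) x) [0..<r]) P) r R'"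
    and R: "0 \<le> R" "R * real N * R' < mod_channel_capacity (\<sigma> / sqrt (real w))"
  shows "cdma_achievable P f b \<sigma> N R"
proof -
  define Q where "Q = map_pmf (\<lambda>x. map (\<lambda>a. dotF2 (h a) x) [0..<r]) P"
  define \<gamma> where "\<gamma> = (R * real N * R' + mod_channel_capacity (\<sigma> / sqrt (real w))) / 2"
  have \<gamma>: "R * real N * R' < \<gamma>" "\<gamma> < mod_channel_capacity (\<sigma> / sqrt (real w))"
  proof -
    have "x < (x + y) / 2 \<and> (x + y) / 2 < y" if "x < y" for x y :: real
      using that by simp
    from this[OF R(2)] show "R * real N * R' < \<gamma>" "\<gamma> < mod_channel_capacity (\<sigma> / sqrt (real w))"
      unfolding \<gamma>_def by blast+
  qed
  have R': "0 \<le> R'" using sw by (simp add: sw_achievable_def)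
  have s: "0 < \<sigma> / sqrt (real w)" using \<sigma> w by simp
  obtain \<psi> \<epsilon> where \<psi>: "\<psi> \<in> borel_measurable borel" "0 < \<epsilon>" "\<And>y. \<epsilon> \<le> \<psi> y" "\<And>y. \<psi> y \<le> 2"
    "\<And>y. \<psi> y + \<psi> (y + 1) = 2" "\<gamma> < (\<integral>z. log 2 (\<psi> z) \<partial>gauss (\<sigma> / sqrt (real w)))"
    using decoding_metric_exists[OF s \<gamma>(2)] by metis
  define \<mu> where "\<mu> = (\<integral>z. log 2 (\<psi> z) \<partial>gauss (\<sigma> / sqrt (real w)))"
  define D where "D = (\<mu> - \<gamma>)\<^sup>2 / (2 * (\<bar>log 2 \<epsilon>\<bar> + 1)\<^sup>2)"
  have "0 < \<bar>log 2 \<epsilon>\<bar> + 1" by linarith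
  then have D: "0 < D"
    unfolding D_def using \<psi>(6) by (intro divide_pos_pos mult_pos_pos zero_less_power) (auto simp: \<mu>_def)
  define k where "k = (\<lambda>n. nat \<lfloor>R * real N * real n\<rfloor>)"
  define l where "l = (\<lambda>n. nat \<lceil>real (k n) * R'\<rceil>)"
  have k_le: "real (k n) \<le> R * real N * real n" for n
    unfolding k_def using R(1) by simp
  have k_ge: "R * real N * real n - 1 \<le> real (k n)" for n
    unfolding k_def by linarith
  \<comment> \<open>The factor 2 pays for rounding up the number of compressed bits.\<close>
  define e where "e = (\<lambda>n. real r * (exp (- real n * D)
      + 2 * exp (- real n * ((\<gamma> - R * real N * R') * ln 2))))"
  have "e \<longlonglongrightarrow> real r * (0 + 2 * 0)"
    unfolding e_def using \<gamma>(1) D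
    by (intro tendsto_mult tendsto_add tendsto_const exp_linear_decay) auto
  then have e0: "e \<longlonglongrightarrow> 0" by simp
  have tail: "real r * (exp (- real n * D) + 2 ^ l n / 2 powr (real n * \<gamma>)) \<le> e n" for n
  proof -
    have "real (k n) * R' \<le> R * real N * real n * R'"
      by (rule mult_right_mono[OF k_le R'])
    moreover have "0 \<le> real (k n) * R'" using R' by simp
    then have "real (l n) \<le> real (k n) * R' + 1" unfolding l_def by linarith
    ultimately have le: "real (l n) - real n * \<gamma> \<le> 1 - real n * (\<gamma> - R * real N * R')"
      by (simp add: algebra_simps)
    have "2 ^ l n / 2 powr (real n * \<gamma>) = 2 powr (real (l n) - real n * \<gamma>)"
      by (simp add: powr_diff powr_realpow)
    also have "\<dots> \<le> 2 powr (1 - real n * (\<gamma> - R * real N * R'))"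
      using le by simp
    also have "\<dots> = 2 * exp (- real n * ((\<gamma> - R * real N * R') * ln 2))"
    proof -
      have "2 powr (1 - x) = 2 * exp (- (x * ln 2))" for x :: real
        by (simp add: powr_diff) (simp add: powr_def exp_minus divide_inverse)
      then show ?thesis by (simp add: mult.assoc)
    qed
    finally show ?thesis unfolding e_def by (intro mult_left_mono add_left_mono) auto
  qed
  have sw_ev: "\<forall>\<^sub>F n in sequentially. \<exists>(B :: nat \<Rightarrow> nat \<Rightarrow> bool) (dec :: (nat \<Rightarrow> nat \<Rightarrow> bool) \<Rightarrow> nat \<Rightarrow> bool list).
      measure_pmf.prob (iid (k n) Q) {\<omega>. \<exists>t<k n. dec (sw_compress r (l n) (k n) B \<omega>) t \<noteq> \<omega> t} \<le> \<delta>"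
    if \<delta>: "0 < \<delta>" for \<delta>
  \<comment> \<open>For R = 0 the source length k is always 0 and the error event is empty;
    otherwise k grows with n and passes the bound given by \<open>sw_achievable\<close>.\<close>
  proof (cases "R = 0")
    case True
    then show ?thesis using \<delta> by (simp add: k_def)
  next
    case False
    then have "0 < R * real N" using R(1) N by simp
    moreover from sw \<delta> obtain k0 where k0: "\<And>k'. k' \<ge> k0 \<Longrightarrow>
      \<exists>(B :: nat \<Rightarrow> nat \<Rightarrow> bool) (dec :: (nat \<Rightarrow> nat \<Rightarrow> bool) \<Rightarrow> nat \<Rightarrow> bool list).
        measure_pmf.prob (iid k' Q) {\<omega>. \<exists>t<k'. dec (sw_compress r (nat \<lceil>real k' * R'\<rceil>) k' B \<omega>) t \<noteq> \<omega> t} \<le> \<delta>"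
      unfolding sw_achievable_def Q_def[symmetric] by blast
    obtain n0 :: nat where n0: "real k0 + 1 \<le> real n0 * (R * real N)"
      using reals_Archimedean3[OF \<open>0 < R * real N\<close>] by (meson less_imp_le)
    have "k0 \<le> k n" if "n0 \<le> n" for n
    proof -
      have "real n0 * (R * real N) \<le> real n * (R * real N)"
        using that \<open>0 < R * real N\<close> by (intro mult_right_mono) auto
      with n0 k_ge[of n] show ?thesis by (simp add: mult_ac)
    qed
    then show ?thesis
      unfolding l_def by (intro eventually_sequentiallyI[of n0] k0)
  qed
  \<comment> \<open>For every m a code with n > m and error at most 1/(m + 1); choice then assembles
    the sequence.\<close>
  have "\<exists>n\<ge>Suc m. \<exists>enc s dec. cdma_decoder_measurable b N (k n) n dec \<and>
      cdma_error_prob P f b \<sigma> N (k n) n enc s dec \<le> inverse (real (Suc m))" for m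
  proof -
    define \<delta> where "\<delta> = inverse (real (Suc m)) / 2"
    have \<delta>: "0 < \<delta>" by (simp add: \<delta>_def)
    have "\<forall>\<^sub>F n in sequentially. e n < \<delta> \<and> Suc m \<le> n \<and>
      (\<exists>(B :: nat \<Rightarrow> nat \<Rightarrow> bool) (dec :: (nat \<Rightarrow> nat \<Rightarrow> bool) \<Rightarrow> nat \<Rightarrow> bool list).
      measure_pmf.prob (iid (k n) Q) {\<omega>. \<exists>t<k n. dec (sw_compress r (l n) (k n) B \<omega>) t \<noteq> \<omega> t} \<le> \<delta>)"
      by (intro eventually_conj sw_ev[OF \<delta>] order_tendstoD(2)[OF e0 \<delta>] eventually_ge_at_top)
    then obtain n where n: "e n < \<delta>" "Suc m \<le> n" and
      "\<exists>(B :: nat \<Rightarrow> nat \<Rightarrow> bool) (dec :: (nat \<Rightarrow> nat \<Rightarrow> bool) \<Rightarrow> nat \<Rightarrow> bool list).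
      measure_pmf.prob (iid (k n) Q) {\<omega>. \<exists>t<k n. dec (sw_compress r (l n) (k n) B \<omega>) t \<noteq> \<omega> t} \<le> \<delta>"
      by (auto dest!: eventually_happens)
    then obtain B and swdec :: "(nat \<Rightarrow> nat \<Rightarrow> bool) \<Rightarrow> nat \<Rightarrow> bool list" where B:
      "measure_pmf.prob (iid (k n) Q) {\<omega>. \<exists>t<k n. swdec (sw_compress r (l n) (k n) B \<omega>) t \<noteq> \<omega> t} \<le> \<delta>"
      by blast
    have "0 < n" using n by simp
    have "\<exists>enc s dec. cdma_decoder_measurable b N (k n) n dec \<and>
      cdma_error_prob P f b \<sigma> N (k n) n enc s dec
      \<le> measure_pmf.prob (iid (k n) Q) {\<omega>. \<exists>t<k n. swdec (sw_compress r (l n) (k n) B \<omega>) t \<noteq> \<omega> t}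
        + real r * (exp (- real n * D) + 2 ^ l n / 2 powr (real n * \<gamma>))"
      unfolding D_def Q_def
    proof (rule linear_code_exists)
      show "f i x = f i x'" if "i < b" "\<forall>a<r. dotF2 (h a) x = dotF2 (h a) x'" for i x x'
        using that by (rule f)
      show "\<gamma> \<le> \<mu>" using \<psi>(6) by (simp add: \<mu>_def)
    qed (fact \<sigma> w rw \<open>0 < n\<close> \<psi> \<mu>_def)+
    then obtain enc s dec where c: "cdma_decoder_measurable b N (k n) n dec"
      "cdma_error_prob P f b \<sigma> N (k n) n enc s dec
      \<le> measure_pmf.prob (iid (k n) Q) {\<omega>. \<exists>t<k n. swdec (sw_compress r (l n) (k n) B \<omega>) t \<noteq> \<omega> t}
        + real r * (exp (- real n * D) + 2 ^ l n / 2 powr (real n * \<gamma>))"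
      by blast
    have "cdma_error_prob P f b \<sigma> N (k n) n enc s dec \<le> \<delta> + \<delta>"
      using c(2) B tail[of n] n(1) by linarith
    then show ?thesis using c(1) n(2) unfolding \<delta>_def by (intro exI[of _ n]) auto
  qed
  then have "\<forall>m. \<exists>n enc s dec. Suc m \<le> n \<and> cdma_decoder_measurable b N (k n) n dec \<and>
      cdma_error_prob P f b \<sigma> N (k n) n enc s dec \<le> inverse (real (Suc m))"
    by blast
  then obtain nn enc s dec where "\<forall>m. Suc m \<le> nn m \<and>
      cdma_decoder_measurable b N (k (nn m)) (nn m) (dec m) \<and>
      cdma_error_prob P f b \<sigma> N (k (nn m)) (nn m) (enc m) (s m) (dec m) \<le> inverse (real (Suc m))"
    unfolding choice_iff by blast
  then have code: "\<And>m. Suc m \<le> nn m"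
    "\<And>m. cdma_decoder_measurable b N (k (nn m)) (nn m) (dec m)"
    "\<And>m. cdma_error_prob P f b \<sigma> N (k (nn m)) (nn m) (enc m) (s m) (dec m) \<le> inverse (real (Suc m))"
    by blast+
  show ?thesis
    unfolding cdma_achievable_def
  proof (rule exI[of _ "\<lambda>m. k (nn m)"], rule exI[of _ nn], rule exI[of _ enc], rule exI[of _ s],
      rule exI[of _ dec], intro conjI allI)
    show "0 < nn m" for m using code(1)[of m] by simp
    show "cdma_decoder_measurable b N (k (nn m)) (nn m) (dec m)" for m by (rule code(2))
    have "0 \<le> cdma_error_prob P f b \<sigma> N (k (nn m)) (nn m) (enc m) (s m) (dec m)" for m
      unfolding cdma_error_prob_def by (rule integral_nonneg_AE) simp
    then show "(\<lambda>m. cdma_error_prob P f b \<sigma> N (k (nn m)) (nn m) (enc m) (s m) (dec m)) \<longlonglongrightarrow> 0"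
      using code(3) by (intro tendsto_sandwich[OF _ _ tendsto_const LIMSEQ_inverse_real_of_nat]) auto
    show "(\<lambda>m. real (k (nn m)) / (real (nn m) * real N)) \<longlonglongrightarrow> R"
    proof (rule tendsto_sandwich)
      have "(\<lambda>m. R - inverse (real (Suc m))) \<longlonglongrightarrow> R - 0"
        by (intro tendsto_diff tendsto_const LIMSEQ_inverse_real_of_nat)
      then show "(\<lambda>m. R - inverse (real (Suc m))) \<longlonglongrightarrow> R" by simp
      show "\<forall>\<^sub>F m in sequentially. real (k (nn m)) / (real (nn m) * real N) \<le> R"
      proof (rule always_eventually, rule allI)
        fix m
        have "0 < real (nn m) * real N" using code(1)[of m] N by simp
        then show "real (k (nn m)) / (real (nn m) * real N) \<le> R"
          using k_le[of "nn m"] by (simp add: pos_divide_le_eq mult_ac)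
      qed
      \<comment> \<open>Rounding k down lowers the rate by at most 1 / (n N), and n > m.\<close>
      show "\<forall>\<^sub>F m in sequentially. R - inverse (real (Suc m)) \<le> real (k (nn m)) / (real (nn m) * real N)"
      proof (rule always_eventually, rule allI)
        fix m
        have pos: "0 < real (nn m) * real N" using code(1)[of m] N by simp
        have "real (Suc m) * 1 \<le> real (nn m) * real N"
          using code(1)[of m] N by (intro mult_mono) auto
        then have "inverse (real (nn m) * real N) \<le> inverse (real (Suc m))"
          by (intro le_imp_inverse_le) auto
        then have "R - inverse (real (Suc m)) \<le> R - inverse (real (nn m) * real N)" by simp
        also have "\<dots> = (R * (real (nn m) * real N) - 1) / (real (nn m) * real N)"
        proof -
          have "R - inverse x = (R * x - 1) / x" if "0 < x" for x
            using that by (simp add: field_simps)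
          then show ?thesis using pos by blast
        qed
        also have "\<dots> \<le> real (k (nn m)) / (real (nn m) * real N)"
          using pos k_ge[of "nn m"] by (intro divide_right_mono) (simp_all add: mult_ac)
        finally show "R - inverse (real (Suc m)) \<le> real (k (nn m)) / (real (nn m) * real N)" .
      qed
    qed (rule tendsto_const)
  qed
qed

section \<open>Entropy and the comparison of the bounds\<close>

lemma entropy_bool:
  fixes P :: "'x pmf" and g :: "'x \<Rightarrow> bool"
  shows "prob_space.entropy (measure_pmf P) 2 (count_space UNIV) g = bool_entropy (map_pmf g P)"
proof -
  interpret information_space "measure_pmf P" 2 by unfold_locales simp
  have "distr (measure_pmf P) (count_space UNIV) g = density (count_space UNIV) (\<lambda>w. ennreal (pmf (map_pmf g P) w))"
    by (simp add: map_pmf_rep_eq flip: measure_pmf_eq_density)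
  then have "distributed (measure_pmf P) (count_space UNIV) g (\<lambda>w. ennreal (pmf (map_pmf g P) w))"
    by (simp add: distributed_def)
  then have "prob_space.entropy (measure_pmf P) 2 (count_space UNIV) g
      = - (\<integral>w. pmf (map_pmf g P) w * log 2 (pmf (map_pmf g P) w) \<partial>count_space UNIV)"
    by (rule entropy_distr) simp
  then show ?thesis
    by (simp add: bool_entropy_def lebesgue_integral_count_space_finite)
qed

lemma bool_entropy_nonneg: "0 \<le> bool_entropy p"
proof -
  have "pmf p w * log 2 (pmf p w) \<le> 0" for w
  proof (cases "pmf p w = 0")
    case False
    then have "0 < pmf p w" by (simp add: pmf_positive_iff[symmetric] less_le)
    then have "log 2 (pmf p w) \<le> 0" by (simp add: pmf_le_1)
    then show ?thesis by (simp add: mult_nonneg_nonpos)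
  qed simp
  then show ?thesis unfolding bool_entropy_def by (simp add: sum_nonpos)
qed

theorem theorem1:
  fixes P :: "('l::finite \<Rightarrow> bool) pmf"
    and r :: nat and h :: "nat \<Rightarrow> 'l \<Rightarrow> bool"
    and b :: nat and f :: "nat \<Rightarrow> ('l \<Rightarrow> bool) \<Rightarrow> 'b"
    and \<sigma> :: real and N :: nat
  assumes r_pos: "0 < r"
    and rows_distinct: "inj_on h {..<r}"
    and f_compat: "\<And>i x x'. i < b \<Longrightarrow> (\<forall>a<r. dotF2 (h a) x = dotF2 (h a) x') \<Longrightarrow> f i x = f i x'"
    and sigma_pos: "0 < \<sigma>"
    and N_gt: "N > r"
  defines "Q \<equiv> map_pmf (\<lambda>x. map (\<lambda>a. dotF2 (h a) x) [0..<r]) P"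
    and "c \<equiv> mod_channel_capacity (\<sigma> / sqrt (real (N div r)))"
  shows "(\<forall>R. 0 \<le> R \<and> ereal R < div_inf c (real N * sw_rate Q r) \<longrightarrow> cdma_achievable P f b \<sigma> N R)
       \<and> div_inf c (real N * sw_rate Q r) \<le> cdma_capacity P f b \<sigma> N
       \<and> div_inf c (real N * Max ((\<lambda>a. prob_space.entropy (measure_pmf P) 2 (count_space UNIV)
                                        (dotF2 (h a))) ` {..<r}))
           \<le> div_inf c (real N * sw_rate Q r)"
proof -
  define w where "w = N div r"
  have w: "0 < w" "r * w \<le> N" using N_gt r_pos by (auto simp: w_def div_greater_zero_iff)
  have N: "0 < N" using N_gt by simp
  have c_pos: "0 < c"
    unfolding c_def by (rule mod_channel_capacity_pos) (use sigma_pos w in \<open>simp add: w_def\<close>)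
  define H where "H = Max ((\<lambda>a. prob_space.entropy (measure_pmf P) 2 (count_space UNIV) (dotF2 (h a))) ` {..<r})"
  have ent_le: "bool_entropy (map_pmf (dotF2 (h a)) P) \<le> H" if "a < r" for a
    unfolding H_def entropy_bool[symmetric] by (rule Max_ge) (use that in auto)
  have H_nonneg: "0 \<le> H"
    using ent_le[OF r_pos] bool_entropy_nonneg[of "map_pmf (dotF2 (h 0)) P"] by linarith
  have ach: "sw_achievable Q r R" if "H < R" for R
  proof (rule sw_achievable_above_entropy)
    fix a assume a: "a < r"
    then have "map_pmf (\<lambda>xs. xs ! a) Q = map_pmf (dotF2 (h a)) P"
      by (simp add: Q_def pmf.map_comp o_def)
    then show "bool_entropy (map_pmf (\<lambda>xs. xs ! a) Q) < R"
      using ent_le[OF a] that by simp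
  qed (use that H_nonneg in \<open>auto simp: Q_def\<close>)
  define S where "S = {R. sw_achievable Q r R}"
  have S: "S \<noteq> {}" "bdd_below S"
    using ach[of "H + 1"] by (auto simp: S_def sw_achievable_def bdd_below_def)
  have rate_nonneg: "0 \<le> sw_rate Q r"
    unfolding sw_rate_def S_def[symmetric] using S by (intro cInf_greatest) (auto simp: S_def sw_achievable_def)
  \<comment> \<open>Achievability is known strictly above H only, which suffices for the
    infimum.\<close>
  have rate_le: "sw_rate Q r \<le> H"
  proof (rule dense_ge)
    fix R assume "H < R"
    then show "sw_rate Q r \<le> R"
      unfolding sw_rate_def S_def[symmetric] using S ach by (intro cInf_lower) (auto simp: S_def)
  qed
  have achievable: "cdma_achievable P f b \<sigma> N R"
    if R: "0 \<le> R" "ereal R < div_inf c (real N * sw_rate Q r)" for R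
  proof -
    have lt: "R * real N * sw_rate Q r < c"
    \<comment> \<open>At Slepian-Wolf rate 0 the left side is 0, and the claim is c > 0.\<close>
    proof (cases "sw_rate Q r = 0")
      case False
      then have pos: "0 < real N * sw_rate Q r" using rate_nonneg N by simp
      then have "R < c / (real N * sw_rate Q r)" using R(2) False N by (simp add: div_inf_def)
      then show ?thesis by (simp only: pos_less_divide_eq[OF pos] mult.assoc)
    qed (use c_pos in simp)
    \<comment> \<open>The infimum need not be attained; the strict inequality leaves room for an
      achievable R' near it. For R = 0 any achievable R' works.\<close>
    obtain R' where R': "R' \<in> S" "R * real N * R' < c"
    proof (cases "R = 0")
      case True
      then show ?thesis using S(1) c_pos that by auto
    next
      case False
      then have pos: "0 < R * real N" using R(1) N by simp
      then have "Inf S < c / (R * real N)"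
        using lt by (simp add: sw_rate_def S_def pos_less_divide_eq mult_ac)
      then obtain R' where "R' \<in> S" "R' < c / (R * real N)"
        using cInf_lessD[OF S(1)] by blast
      then show ?thesis using pos that by (simp add: pos_less_divide_eq mult_ac)
    qed
    show ?thesis
    proof (rule cdma_achievable_rate)
      show "f i x = f i x'" if "i < b" "\<forall>a<r. dotF2 (h a) x = dotF2 (h a) x'" for i x x'
        using that by (rule f_compat)
      show "sw_achievable (map_pmf (\<lambda>x. map (\<lambda>a. dotF2 (h a) x) [0..<r]) P) r R'"
        using R'(1) by (simp add: S_def Q_def)
      show "R * real N * R' < mod_channel_capacity (\<sigma> / sqrt (real w))"
        using R'(2) by (simp add: c_def w_def)
    qed (fact sigma_pos w N R(1))+
  qed
  have div_pos: "0 < div_inf c (real N * sw_rate Q r)"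
  proof (cases "sw_rate Q r = 0")
    case False
    then have "0 < c / (real N * sw_rate Q r)" using c_pos rate_nonneg N by simp
    then show ?thesis using False N by (simp add: div_inf_def)
  qed (simp add: div_inf_def)
  have "div_inf c (real N * sw_rate Q r) \<le> cdma_capacity P f b \<sigma> N"
  proof (rule dense_le)
    fix y assume y: "y < div_inf c (real N * sw_rate Q r)"
    have cap: "ereal R \<le> cdma_capacity P f b \<sigma> N"
      if "0 \<le> R" "ereal R < div_inf c (real N * sw_rate Q r)" for R
      unfolding cdma_capacity_def using achievable[OF that] by (intro Sup_upper) auto
    show "y \<le> cdma_capacity P f b \<sigma> N"
    proof (cases y)
      case (real R)
      \<comment> \<open>y may be negative whereas \<open>achievable\<close> asks for R \<ge> 0; as
        the bound is positive, the maximum with 0 still lies below it.\<close>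
      then have "ereal (max R 0) < div_inf c (real N * sw_rate Q r)"
        using y div_pos by (auto simp: max_def zero_ereal_def)
      then have "ereal (max R 0) \<le> cdma_capacity P f b \<sigma> N" by (intro cap) auto
      then show ?thesis using real by (auto intro: order_trans[rotated])
    qed (use y in auto)
  qed
  moreover have "div_inf c (real N * H) \<le> div_inf c (real N * sw_rate Q r)"
  \<comment> \<open>A zero rate makes the right side infinite; a positive one makes H positive too,
    so both sides are genuine quotients.\<close>
  proof (cases "sw_rate Q r = 0")
    case False
    then have "0 < sw_rate Q r" using rate_nonneg by simp
    then show ?thesis
      using rate_le N c_pos by (auto simp: div_inf_def intro!: divide_left_mono)
  qed (simp add: div_inf_def)
  ultimately show ?thesis using achievable unfolding H_def by blast
qed

end
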